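(* Let $\theta>0$. Let $\mathbf{W}=(W_{n,k})_{n\in\mathbb{N},k\in[n]}$ be an array of non-negative integrable random variables (not necessarily ordered), and suppose that, conditionally given $\mathbf{W}$, $(X_k)_{k\in\mathbb{N}}$ are mutually independent non-negative integer-valued random variables with $\lambda_k(\mathbf{W}):=\mathbb{E}[X_k\mid\mathbf{W}]\in[0,\infty)$. Let $S_n=\sum_{k=1}^nW_{n,k}X_k$ and $$\varepsilon_n^{\mathrm{os}}(\mathbf{W}):=\delta_n^{\mathrm{os}}+\frac2\theta D_n^{*,\mathrm{os}}+\frac2\theta\sum_{k=1}^n\lambda_k(\mathbf{W})W_{n,k}\frac{d_{TV}(X_k^*,X_k+1\mid\mathbf{W})}{\mathbb{P}(X_k=x_{\min}^{(k)}(\mathbf{W})\mid\mathbf{W})}+|W_{\max}^{(n)}-1|.$$ Let $$C_1:=2\theta^2+(6\theta+10\theta\,\zeta(1+\theta))\max\Big\{\frac{e^{-\theta\gamma}}{\Gamma(\theta)},k_\theta\Big\},\qquad C_2:=3\,(2\theta+4\theta\,\zeta(1+\theta))^{\theta}.$$ Then for every $n\in\mathbb{N}$, $$d_K(S_n,D_\theta)\le\begin{cases}C_1\,\mathbb{E}[\varepsilon_n^{\mathrm{os}}(\mathbf{W})],&\theta\ge1,\\2\theta^2\,\mathbb{E}[\varepsilon_n^{\mathrm{os}}(\mathbf{W})]+C_2\,(\mathbb{E}[\varepsilon_n^{\mathrm{os}}(\mathbf{W})])^\theta,&\theta\in(0,1).\end{cases}$$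
   Context: $[n]=\{1,\dots,n\}$. $D_\theta$ has the generalized Dickman distribution with mean $\theta$: the unique non-negative solution (in law) of $D\stackrel{d}{=}U^{1/\theta}(D+1)$ with $U$ uniform on $[0,1]$ independent of $D$. Let $p_\theta$ be its density; $k_\theta>0$ is a constant with $p_\theta(x)\le k_\theta$ for all $x\ge1$ (such a constant exists). $\gamma$ is the Euler–Mascheroni constant, $\zeta$ the Riemann zeta function. $d_K(X,Y)=\sup_{t\ge0}|\mathbb{P}(X\le t)-\mathbb{P}(Y\le t)|$ for non-negative $X,Y$. $0\le W_{n,(1)}\le\dots\le W_{n,(n)}=:W_{\max}^{(n)}$ are the order statistics of $(W_{n,1},\dots,W_{n,n})$, $W_{n,(0)}:=0$, and $\sigma$ is a $\mathbf{W}$-measurable permutation of $[n]$ with $W_{n,\sigma(k)}=W_{n,(k)}$ (ties broken arbitrarily). $\Delta_{n,k}^{\mathrm{os}}:=\theta(W_{n,(k)}-W_{n,(k-1)})$, $D_{n,k}^{\mathrm{os}}:=\sum_{j=1}^k(\lambda_{\sigma(j)}(\mathbf{W})W_{n,(j)}-\Delta_{n,j}^{\mathrm{os}})$, $\delta_n^{\mathrm{os}}:=\max_{k\in[n]}(W_{n,(k)}-W_{n,(k-1)})$, $D_n^{*,\mathrm{os}}:=\max_{k\in[n]}|D_{n,k}^{\mathrm{os}}|$. $x_{\min}^{(k)}(\mathbf{W}):=\min\{x\in\mathbb{N}_0:\mathbb{P}(X_k=x\mid\mathbf{W})>0\}$. Conditionally given $\mathbf{W}$, $X_k^*$ has the size-biased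 law of $X_k$: $\mathbb{E}[X_kf(X_k)\mid\mathbf{W}]=\lambda_k(\mathbf{W})\mathbb{E}[f(X_k^* )\mid\mathbf{W}]$ for all $f$ for which the expectations exist. $d_{TV}(\cdot,\cdot\mid\mathbf{W})$ is the total variation distance (supremum over events of the difference of probabilities) between conditional laws given $\mathbf{W}$. A summand with $\lambda_k(\mathbf{W})=0$ is read as $0$. *)

theory Defs
  imports "HOL-Probability.Probability" "HOL-Combinatorics.Permutations"
begin

section \<open>The generalized Dickman distribution\<close>

text \<open>
  Solutions in law of \<open>D = U powr (1/\<theta>) * (D + 1)\<close> with \<open>D \<ge> 0\<close>, \<open>U\<close> uniform on the unit
  interval, and \<open>U\<close>, \<open>D\<close> independent on the right-hand side (hence the product measure).
  The solution is unique, so this predicate determines \<open>\<nu>\<close>.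
\<close>

definition dickman_law :: "real \<Rightarrow> real measure \<Rightarrow> bool" where
  "dickman_law \<theta> \<nu> \<longleftrightarrow>
     prob_space \<nu> \<and> sets \<nu> = sets borel \<and> (AE d in \<nu>. 0 \<le> d) \<and>
     distr (uniform_measure lborel {0..1} \<Otimes>\<^sub>M \<nu>) borel
       (\<lambda>(u, d). u powr (1 / \<theta>) * (d + 1)) = \<nu>"

definition kolmogorov_dist :: "real measure \<Rightarrow> real measure \<Rightarrow> real" where
  "kolmogorov_dist \<mu> \<nu> = (SUP t\<in>{0..}. \<bar>cdf \<mu> t - cdf \<nu> t\<bar>)"

text \<open>The Riemann zeta function at real arguments \<open>s > 1\<close>.\<close>

definition zeta_real :: "real \<Rightarrow> real" where
  "zeta_real s = (\<Sum>n. 1 / real (Suc n) powr s)"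


section \<open>Conditioning on the weights\<close>

text \<open>The sigma-algebra on \<open>M\<close> generated by the triangular array \<open>W n k\<close>, \<open>n \<ge> 1\<close>, \<open>1 \<le> k \<le> n\<close>.\<close>

definition array_sigma :: "'a measure \<Rightarrow> (nat \<Rightarrow> nat \<Rightarrow> 'a \<Rightarrow> real) \<Rightarrow> 'a measure" where
  "array_sigma M W =
     sigma (space M) (\<Union>n\<in>{1..}. \<Union>k\<in>{1..n}. {W n k -` B \<inter> space M | B. B \<in> sets borel})"

definition cond_prob_sub :: "'a measure \<Rightarrow> 'a measure \<Rightarrow> 'a set \<Rightarrow> 'a \<Rightarrow> real" where
  "cond_prob_sub M F A = real_cond_exp M F (indicator A)"

definition cond_indep_nat ::
    "'a measure \<Rightarrow> 'a measure \<Rightarrow> (nat \<Rightarrow> 'a \<Rightarrow> nat) \<Rightarrow> nat set \<Rightarrow> bool" where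
  "cond_indep_nat M F X I \<longleftrightarrow>
     (\<forall>k\<in>I. X k \<in> measurable M (count_space UNIV)) \<and>
     (\<forall>J A. J \<subseteq> I \<longrightarrow> finite J \<longrightarrow> J \<noteq> {} \<longrightarrow>
        (AE \<omega> in M. cond_prob_sub M F {\<omega>\<in>space M. \<forall>k\<in>J. X k \<omega> \<in> A k} \<omega> =
                    (\<Prod>k\<in>J. cond_prob_sub M F {\<omega>\<in>space M. X k \<omega> \<in> A k} \<omega>)))"

text \<open>
  \<open>\<mu>\<close> is a version of the (regular) conditional law of the integer-valued variable \<open>Y\<close> given \<open>F\<close>.
  Such a version always exists and is unique up to a null set, see below.
\<close>

definition cond_law :: "'a measure \<Rightarrow> 'a measure \<Rightarrow> ('a \<Rightarrow> nat) \<Rightarrow> ('a \<Rightarrow> nat pmf) \<Rightarrow> bool" where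
  "cond_law M F Y \<mu> \<longleftrightarrow>
     (\<forall>x. (\<lambda>\<omega>. pmf (\<mu> \<omega>) x) \<in> borel_measurable F) \<and>
     (\<forall>x. AE \<omega> in M. pmf (\<mu> \<omega>) x = cond_prob_sub M F {\<omega>\<in>space M. Y \<omega> = x} \<omega>)"

text \<open>
  \<open>nn_cond_exp\<close> rather than \<open>real_cond_exp\<close>: the variable \<open>Y\<close> need not be integrable, only its
  conditional expectation is required to be finite.
\<close>

definition cond_mean :: "'a measure \<Rightarrow> 'a measure \<Rightarrow> ('a \<Rightarrow> nat) \<Rightarrow> 'a \<Rightarrow> ennreal" where
  "cond_mean M F Y = nn_cond_exp M F (\<lambda>\<omega>. ennreal (real (Y \<omega>)))"

text \<open>\<open>q\<close> is the size-biased law of \<open>p\<close>; meaningful when \<open>p\<close> has mean in the open interval from 0 to infinity.\<close>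

definition size_biased :: "nat pmf \<Rightarrow> nat pmf \<Rightarrow> bool" where
  "size_biased p q \<longleftrightarrow>
     (\<forall>f :: nat \<Rightarrow> real.
        integrable (measure_pmf p) (\<lambda>x. real x * f x) \<longrightarrow> integrable (measure_pmf q) f \<longrightarrow>
        measure_pmf.expectation p (\<lambda>x. real x * f x) =
        measure_pmf.expectation p real * measure_pmf.expectation q f)"

definition tv_dist :: "nat pmf \<Rightarrow> nat pmf \<Rightarrow> real" where
  "tv_dist p q = (SUP A. \<bar>measure_pmf.prob p A - measure_pmf.prob q A\<bar>)"

definition x_min :: "nat pmf \<Rightarrow> nat" where
  "x_min p = (LEAST x. pmf p x > 0)"


section \<open>Order statistics and the error term\<close>

definition order_stat :: "nat \<Rightarrow> (nat \<Rightarrow> real) \<Rightarrow> nat \<Rightarrow> real" where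
  "order_stat n w k = (if k = 0 then 0 else sort (map w [1..<Suc n]) ! (k - 1))"

text \<open>
  The deterministic quantities below are evaluated at a realisation: \<open>w k\<close> is the value of \<open>W n k\<close>,
  \<open>l k\<close> that of the conditional mean of \<open>X k\<close>, \<open>s\<close> that of the sorting permutation, and \<open>p k\<close>, \<open>q k\<close>
  are the conditional laws of \<open>X k\<close> and of its size-biased version.
\<close>

definition Delta_os :: "real \<Rightarrow> nat \<Rightarrow> (nat \<Rightarrow> real) \<Rightarrow> nat \<Rightarrow> real" where
  "Delta_os \<theta> n w k = \<theta> * (order_stat n w k - order_stat n w (k - 1))"

definition D_os ::
    "real \<Rightarrow> nat \<Rightarrow> (nat \<Rightarrow> real) \<Rightarrow> (nat \<Rightarrow> real) \<Rightarrow> (nat \<Rightarrow> nat) \<Rightarrow> nat \<Rightarrow> real" where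
  "D_os \<theta> n w l s k = (\<Sum>j=1..k. l (s j) * order_stat n w j - Delta_os \<theta> n w j)"

definition delta_max_os :: "nat \<Rightarrow> (nat \<Rightarrow> real) \<Rightarrow> real" where
  "delta_max_os n w = Max ((\<lambda>k. order_stat n w k - order_stat n w (k - 1)) ` {1..n})"

definition D_max_os ::
    "real \<Rightarrow> nat \<Rightarrow> (nat \<Rightarrow> real) \<Rightarrow> (nat \<Rightarrow> real) \<Rightarrow> (nat \<Rightarrow> nat) \<Rightarrow> real" where
  "D_max_os \<theta> n w l s = Max ((\<lambda>k. \<bar>D_os \<theta> n w l s k\<bar>) ` {1..n})"

text \<open>A summand with \<open>l k = 0\<close> vanishes whatever \<open>q k\<close> is; the denominator is always positive.\<close>

definition eps_os ::
    "real \<Rightarrow> nat \<Rightarrow> (nat \<Rightarrow> real) \<Rightarrow> (nat \<Rightarrow> real) \<Rightarrow> (nat \<Rightarrow> nat) \<Rightarrow>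
     (nat \<Rightarrow> nat pmf) \<Rightarrow> (nat \<Rightarrow> nat pmf) \<Rightarrow> real" where
  "eps_os \<theta> n w l s p q =
     delta_max_os n w + 2 / \<theta> * D_max_os \<theta> n w l s
     + 2 / \<theta> * (\<Sum>k=1..n. l k * w k *
          (tv_dist (q k) (map_pmf Suc (p k)) / pmf (p k) (x_min (p k))))
     + \<bar>order_stat n w n - 1\<bar>"

text \<open>A sorting permutation of \<open>{1..n}\<close> (ties broken arbitrarily), measurable with respect to \<open>F\<close>.\<close>

definition sorting_perm ::
    "'a measure \<Rightarrow> nat \<Rightarrow> (nat \<Rightarrow> 'a \<Rightarrow> real) \<Rightarrow> ('a \<Rightarrow> nat \<Rightarrow> nat) \<Rightarrow> bool" where
  "sorting_perm F n w s \<longleftrightarrow>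
     (\<forall>k\<in>{1..n}. (\<lambda>\<omega>. s \<omega> k) \<in> measurable F (count_space UNIV)) \<and>
     (\<forall>\<omega>\<in>space F. s \<omega> permutes {1..n} \<and>
        (\<forall>k\<in>{1..n}. w (s \<omega> k) \<omega> = order_stat n (\<lambda>j. w j \<omega>) k))"

text \<open>Real powers with positive exponent on \<open>[0, \<infinity>]\<close>.\<close>

definition ennreal_powr :: "ennreal \<Rightarrow> real \<Rightarrow> ennreal" where
  "ennreal_powr x a = (if x = \<infinity> then \<infinity> else ennreal (enn2real x powr a))"

definition C1_const :: "real \<Rightarrow> real \<Rightarrow> real" where
  "C1_const \<theta> k = 2 * \<theta>\<^sup>2 + (6 * \<theta> + 10 * \<theta> * zeta_real (1 + \<theta>)) *
     max (exp (- \<theta> * euler_mascheroni) / Gamma \<theta>) k"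

definition C2_const :: "real \<Rightarrow> real" where
  "C2_const \<theta> = 3 * (2 * \<theta> + 4 * \<theta> * zeta_real (1 + \<theta>)) powr \<theta>"


section \<open>Existence of conditional and size-biased laws\<close>

lemma subalgebra_array_sigma:
  assumes "\<And>n k. 1 \<le> k \<Longrightarrow> k \<le> n \<Longrightarrow> W n k \<in> borel_measurable M"
  shows "subalgebra M (array_sigma M W)"
proof -
  have *: "(\<Union>n\<in>{1..}. \<Union>k\<in>{1..n}. {W n k -` B \<inter> space M | B. B \<in> sets borel}) \<subseteq> sets M"
    using assms by (auto intro!: measurable_sets)
  show ?thesis
    unfolding subalgebra_def array_sigma_def
    using * sets.space_closed[of M] sets.sigma_sets_subset[OF *]
    by (subst sets_measure_of) (auto simp: space_measure_of_conv)
qed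

lemma cond_law_exists:
  assumes "prob_space M" "subalgebra M F" and Y[measurable]: "Y \<in> measurable M (count_space UNIV)"
  shows "\<exists>\<mu>. cond_law M F Y \<mu>"
proof -
  interpret prob_space M by fact
  interpret finite_measure_subalgebra M F
    by standard (fact assms(2))
  define A where "A x = {\<omega>\<in>space M. Y \<omega> = x}" for x
  have A[measurable]: "A x \<in> sets M" for x unfolding A_def by measurable
  define c where "c x = nn_cond_exp M F (indicator (A x))" for x :: nat
  have c[measurable]: "c x \<in> borel_measurable F" for x unfolding c_def by simp
  have c_M[measurable]: "c x \<in> borel_measurable M" for x
    by (rule measurable_from_subalg[OF assms(2) c])
  have ind: "(\<Sum>x. indicator (A x) \<omega> :: ennreal) = 1" if "\<omega> \<in> space M" for \<omega>
  proof -
    have "(\<lambda>x. indicator (A x) \<omega> :: ennreal) = (\<lambda>x. if x = Y \<omega> then 1 else 0)"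
      using that by (auto simp: A_def indicator_def fun_eq_iff)
    then show ?thesis
      using sums_unique[OF sums_single[of "Y \<omega>" "\<lambda>_. 1::ennreal"]] by simp
  qed
  have sum1: "AE \<omega> in M. (\<Sum>x. c x \<omega>) = 1"
  proof -
    have "AE \<omega> in M. (\<Sum>x. c x \<omega>) = nn_cond_exp M F (\<lambda>_. 1) \<omega>"
    proof (rule nn_cond_exp_charact)
      fix B assume B: "B \<in> sets F"
      then have [measurable]: "B \<in> sets M" using assms(2) by (auto simp: subalgebra_def)
      have "(\<integral>\<^sup>+ \<omega> \<in> B. (\<Sum>x. c x \<omega>) \<partial>M) = (\<integral>\<^sup>+ \<omega>. (\<Sum>x. indicator B \<omega> * c x \<omega>) \<partial>M)"
        by (simp add: mult.commute)
      also have "\<dots> = (\<Sum>x. \<integral>\<^sup>+ \<omega>. indicator B \<omega> * c x \<omega> \<partial>M)"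
        by (rule nn_integral_suminf) measurable
      also have "\<dots> = (\<Sum>x. \<integral>\<^sup>+ \<omega>. indicator B \<omega> * indicator (A x) \<omega> \<partial>M)"
        unfolding c_def using B by (subst nn_cond_exp_intg) auto
      also have "\<dots> = (\<integral>\<^sup>+ \<omega>. (\<Sum>x. indicator B \<omega> * indicator (A x) \<omega>) \<partial>M)"
        by (rule nn_integral_suminf[symmetric]) measurable
      also have "\<dots> = (\<integral>\<^sup>+ \<omega> \<in> B. 1 \<partial>M)"
        by (rule nn_integral_cong) (simp add: ind)
      finally show "(\<integral>\<^sup>+ \<omega> \<in> B. 1 \<partial>M) = (\<integral>\<^sup>+ \<omega> \<in> B. (\<Sum>x. c x \<omega>) \<partial>M)" by simp
    qed auto
    moreover have "AE \<omega> in M. 1 = nn_cond_exp M F (\<lambda>_. 1) \<omega>"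
      by (rule nn_cond_exp_F_meas) simp
    ultimately show ?thesis by eventually_elim simp
  qed
  define \<mu> where "\<mu> \<omega> = (if (\<Sum>x. c x \<omega>) = 1 then embed_pmf (\<lambda>x. enn2real (c x \<omega>)) else return_pmf 0)"
    for \<omega>
  have pmf_mu: "pmf (\<mu> \<omega>) x = (if (\<Sum>x. c x \<omega>) = 1 then enn2real (c x \<omega>) else indicator {0} x)"
    for \<omega> x
  proof (cases "(\<Sum>x. c x \<omega>) = 1")
    case True
    have "c x \<omega> < top" for x
      using ennreal_suminf_neq_top[of] True sum_le_suminf[of "\<lambda>x. c x \<omega>" "{x}"]
      by (simp add: le_less_trans)
    then have e: "ennreal (enn2real (c x \<omega>)) = c x \<omega>" for x by simp
    have "pmf (embed_pmf (\<lambda>x. enn2real (c x \<omega>))) x = enn2real (c x \<omega>)"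
      by (rule pmf_embed_pmf) (simp_all add: e nn_integral_count_space_nat True)
    then show ?thesis using True by (simp add: \<mu>_def)
  qed (auto simp: \<mu>_def indicator_def)
  have "cond_law M F Y \<mu>"
    unfolding cond_law_def
  proof (intro conjI allI)
    fix x
    show "(\<lambda>\<omega>. pmf (\<mu> \<omega>) x) \<in> borel_measurable F"
      unfolding pmf_mu by measurable
    have neg: "AE \<omega> in M. 0 = nn_cond_exp M F (\<lambda>_. 0) \<omega>"
      by (rule nn_cond_exp_F_meas) simp
    have neg0: "ennreal (- indicator (A x) \<omega>) = 0" for \<omega>
      by (simp add: ennreal_neg)
    from neg sum1 show "AE \<omega> in M. pmf (\<mu> \<omega>) x = cond_prob_sub M F {\<omega>\<in>space M. Y \<omega> = x} \<omega>"
      by eventually_elim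
        (simp add: pmf_mu cond_prob_sub_def real_cond_exp_def c_def A_def[symmetric]
          ennreal_indicator neg0)
  qed
  then show ?thesis by blast
qed

lemma size_biased_exists:
  assumes fin: "integrable (measure_pmf p) real" and pos: "measure_pmf.expectation p real > 0"
  shows "\<exists>q. size_biased p q"
proof -
  define m where "m = measure_pmf.expectation p real"
  have m: "m > 0" using pos by (simp add: m_def)
  define q where "q = embed_pmf (\<lambda>x. real x * pmf p x / m)"
  have "(\<integral>\<^sup>+x. ennreal (real x * pmf p x / m) \<partial>count_space UNIV)
      = (\<integral>\<^sup>+x. ennreal (real x) / ennreal m \<partial>measure_pmf p)"
    unfolding nn_integral_measure_pmf
    using m by (intro nn_integral_cong) (simp add: ennreal_mult[symmetric] divide_ennreal mult.commute)
  also have "\<dots> = (\<integral>\<^sup>+x. ennreal (real x) \<partial>measure_pmf p) / ennreal m"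
    by (simp add: nn_integral_divide)
  also have "\<dots> = 1"
    using m by (subst nn_integral_eq_integral[OF fin]) (simp_all add: m_def[symmetric] divide_ennreal)
  finally have one: "(\<integral>\<^sup>+x. ennreal (real x * pmf p x / m) \<partial>count_space UNIV) = 1" .
  have pmf_q: "pmf q x = real x * pmf p x / m" for x
    unfolding q_def by (rule pmf_embed_pmf[OF _ one]) (use m in simp)
  have "size_biased p q"
    unfolding size_biased_def
  proof (intro allI impI)
    fix f :: "nat \<Rightarrow> real"
    have d: "measure_pmf q = density (measure_pmf p) (\<lambda>x. ennreal (real x / m))"
      unfolding measure_pmf_eq_density[of q] measure_pmf_eq_density[of p]
      by (subst density_density_eq) (use m in \<open>auto simp: pmf_q ennreal_mult[symmetric] mult.commute\<close>)
    have "measure_pmf.expectation q f = measure_pmf.expectation p (\<lambda>x. real x / m * f x)"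
      unfolding d using m by (subst integral_density) auto
    also have "\<dots> = measure_pmf.expectation p (\<lambda>x. real x * f x) / m"
      by simp
    finally show "measure_pmf.expectation p (\<lambda>x. real x * f x) =
        measure_pmf.expectation p real * measure_pmf.expectation q f"
      using m by (simp add: m_def[symmetric])
  qed
  then show ?thesis ..
qed

end

theory Submission
  imports Defs
begin

text \<open>
  Let \<open>F\<close> be the distribution function of \<open>\<nu>\<close>, \<open>G\<close> that of the weighted sum for frozen weights, and
  \<open>e = \<theta> * \<epsilon>\<close>. Evaluated at indicators of \<open>{..t}\<close>, the size-bias identity of \<open>\<nu>\<close> says
  \<open>t F(t) = I(t) + \<theta> (I(t) - I(t - 1))\<close> with \<open>I(t)\<close> the integral of \<open>F\<close> over \<open>{0..t}\<close>, while \<open>G\<close> satisfies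
  the same equation up to an error of at most \<open>e * G(t)\<close>. For \<open>H = G - F\<close> with integral \<open>K\<close> this reads
  \<open>t H(t) = K(t) + \<theta> (K(t) - K(t - 1)) + r(t)\<close>, \<open>\<bar>r(t)\<bar> \<le> e * G(t)\<close>. At a maximum of \<open>K\<close> the right
  derivative \<open>H\<close> is nonpositive, which forces \<open>K \<le> e\<close>; likewise for \<open>-K\<close>. Dividing by \<open>t\<close> bounds \<open>H\<close>
  for \<open>t \<ge> 1\<close>. On \<open>{0..1}\<close>, where \<open>F(t) = c t\<^sup>\<theta>\<close>, comparing \<open>K\<close> with explicit supersolutions and
  bootstrapping on \<open>G \<le> F + \<bar>H\<bar>\<close> bounds \<open>H\<close> down to \<open>t = 8 e\<close>, and monotonicity covers the rest.
  The random weights are handled by conditioning and, for \<open>\<theta> < 1\<close>, by concavity of \<open>x \<mapsto> x\<^sup>\<theta>\<close>.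
\<close>

text \<open>The obstacle is the division by \<open>t\<close> near 0, where a mere error
  \<open>e\<close> in the equation would turn into \<open>e / t\<close>. It is met by keeping the
  error relative: up to \<open>\<bar>H t\<bar>\<close> the factor \<open>G t\<close> is
  \<open>c * t powr \<theta>\<close> there, so \<open>r t / t\<close> is of order
  \<open>e * t powr (\<theta> - 1)\<close> plus \<open>e * \<bar>H t\<bar> / t\<close>, and the
  second term can be absorbed once \<open>t\<close> exceeds a multiple of \<open>e\<close>. At this
  cutoff the first term has order \<open>e powr \<theta>\<close> if \<open>\<theta> < 1\<close>,
  while for \<open>\<theta> \<ge> 1\<close> it has at most order \<open>e\<close> on the whole unit
  interval; this is the origin of the two regimes. Distribution functions are only right-continuous,
  so all comparisons for \<open>K\<close> work with right derivatives. The constants produced are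
  \<open>2 * \<theta>\<^sup>2 + 16 * \<theta> * k\<close> and
  \<open>3 * (6 * \<theta>) powr \<theta>\<close>, that is, \<open>C1_const\<close> and
  \<open>C2_const\<close> with the zeta value replaced by 1 and the maximum by
  \<open>k\<close>.\<close>

section \<open>Perturbing the integral equation of the Dickman distribution function\<close>

text \<open>A positive right derivative at a maximiser would let \<open>f\<close> exceed its
  maximum. Since nothing to the left of the maximiser enters, one at the left end \<open>a\<close>
  is treated like any other, and a boundary value appears only at \<open>b\<close>.\<close>

lemma max_principle_right:
  fixes f :: "real \<Rightarrow> real"
  assumes ab: "a \<le> b" and cont: "continuous_on {a..b} f" and fb: "f b \<le> 0"
    and deriv: "\<And>t. \<lbrakk>a \<le> t; t < b; 0 < f t; \<And>s. \<lbrakk>a \<le> s; s \<le> b\<rbrakk> \<Longrightarrow> f s \<le> f t\<rbrakk>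
      \<Longrightarrow> \<exists>D>0. (f has_real_derivative D) (at t within {t..b})"
    and t: "a \<le> t" "t \<le> b"
  shows "f t \<le> 0"
proof -
  obtain x where x: "x \<in> {a..b}" "\<And>s. s \<in> {a..b} \<Longrightarrow> f s \<le> f x"
    using continuous_attains_sup[OF compact_Icc _ cont] ab by auto
  have "f x \<le> 0"
  proof (rule ccontr)
    assume "\<not> f x \<le> 0"
    then have pos: "f x > 0" by simp
    then have "x < b" using fb x(1) by (cases "x = b") auto
    then obtain D where "D > 0" "(f has_real_derivative D) (at x within {x..b})"
      using deriv[of x] x pos by auto
    from has_real_derivative_pos_inc_right[OF this(2,1)] obtain d
      where d: "d > 0" "\<And>h. 0 < h \<Longrightarrow> x + h \<in> {x..b} \<Longrightarrow> h < d \<Longrightarrow> f x < f (x + h)" by auto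
    define h where "h = min (d/2) (b - x)"
    have "h > 0" "h < d" "x + h \<in> {x..b}" using d \<open>x < b\<close> by (auto simp: h_def min_def)
    then have "f x < f (x + h)" using d(2) by blast
    moreover have "f (x + h) \<le> f x" using \<open>x + h \<in> {x..b}\<close> x(1) by (intro x(2)) auto
    ultimately show False by simp
  qed
  then show ?thesis using x(2)[of t] t by auto
qed

text \<open>The assumption \<open>tail\<close> is the trace of a finite mean. It makes
  \<open>t * H t\<close> vanish at infinity, which supplies the boundary value for the maximum
  principle.\<close>

locale halfline_cdf =
  fixes F :: "real \<Rightarrow> real"
  assumes mono: "mono F"
    and right_cont: "\<And>t. continuous (at_right t) F"
    and zero_neg: "\<And>t. t < 0 \<Longrightarrow> F t = 0"
    and le_1: "\<And>t. F t \<le> 1"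
    and tail: "((\<lambda>t. t * (1 - F t)) \<longlongrightarrow> 0) at_top"
begin

definition I :: "real \<Rightarrow> real" where "I t = integral {0..t} F"

lemma integrable: "F integrable_on {a..b}"
  using mono integrable_on_mono_on mono_imp_mono_on by blast

lemma nonneg: "0 \<le> F t"
  using monoD[OF mono, of "-1 + min t 0" t] zero_neg[of "-1 + min t 0"] by auto

lemma lim_1: "(F \<longlongrightarrow> 1) at_top"
proof -
  have "((\<lambda>t. 1 - F t) \<longlongrightarrow> 0) at_top"
  proof (rule tendsto_sandwich[OF _ _ tendsto_const tail])
    show "\<forall>\<^sub>F t in at_top. 0 \<le> 1 - F t" using le_1 by simp
    show "\<forall>\<^sub>F t in at_top. 1 - F t \<le> t * (1 - F t)"
      using eventually_ge_at_top[of 1]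
    proof eventually_elim
      case (elim t)
      then show ?case using mult_right_mono[of 1 t "1 - F t"] le_1[of t] by simp
    qed
  qed
  from tendsto_diff[OF tendsto_const[of 1] this] show ?thesis by simp
qed

lemma I_neg: "t \<le> 0 \<Longrightarrow> I t = 0"
  unfolding I_def by (cases "t = 0") auto

lemma I_diff: "0 \<le> s \<Longrightarrow> s \<le> t \<Longrightarrow> I t - I s = integral {s..t} F"
  unfolding I_def
  using Henstock_Kurzweil_Integration.integral_combine[OF _ _ integrable, of 0 s t] by linarith

lemma I_diff_bounds:
  assumes "0 \<le> s" "s \<le> t"
  shows "(t - s) * F s \<le> I t - I s" "I t - I s \<le> (t - s) * F t"
proof -
  have "integral {s..t} (\<lambda>_. F s) \<le> integral {s..t} F"
    by (rule integral_le) (use integrable monoD[OF mono] in auto)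
  then show "(t - s) * F s \<le> I t - I s" using assms by (simp add: I_diff)
  have "integral {s..t} F \<le> integral {s..t} (\<lambda>_. F t)"
    by (rule integral_le) (use integrable monoD[OF mono] in auto)
  then show "I t - I s \<le> (t - s) * F t" using assms by (simp add: I_diff)
qed

lemma continuous_on_I: "continuous_on {a..b} I"
proof -
  have "continuous_on {0..max b 0} I"
    unfolding I_def by (rule indefinite_integral_continuous_1) (rule integrable)
  moreover have "continuous_on {min a 0..0} I"
    by (rule continuous_on_eq[of _ "\<lambda>_. 0"]) (auto simp: I_neg)
  ultimately have "continuous_on ({min a 0..0} \<union> {0..max b 0}) I"
    by (intro continuous_on_closed_Un) auto
  then show ?thesis by (rule continuous_on_subset) auto
qed

lemma I_has_derivative:
  assumes "0 \<le> t" "t < b"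
  shows "(I has_real_derivative F t) (at t within {t..b})"
proof -
  have "continuous (at t within {t..b}) F"
    using right_cont[of t] assms by (simp add: continuous_within at_within_Icc_at_right)
  then have "((\<lambda>u. integral {t..u} F) has_vector_derivative F t) (at t within {t..b} - {})"
    using assms by (intro integral_has_vector_derivative_continuous_at integrable) auto
  then have "((\<lambda>u. I t + integral {t..u} F) has_real_derivative F t) (at t within {t..b})"
    unfolding has_real_derivative_iff_has_vector_derivative
    by (intro derivative_eq_intros) auto
  then show ?thesis
  proof (rule has_field_derivative_transform_within[OF _ zero_less_one])
    show "I t + integral {t..x} F = I x" if "x \<in> {t..b}" for x
      using I_diff[of t x] assms that by simp
  qed (use assms in auto)
qed

lemma I_increment_bounds:
  assumes "1 \<le> t"
  shows "F (t - 1) \<le> I t - I (t - 1)" "I t - I (t - 1) \<le> 1"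
  using I_diff_bounds[of "t - 1" t] assms le_1[of t] by auto

end

text \<open>At \<open>t = 1\<close> the power law reads \<open>c = F 1\<close>, so
  \<open>\<theta> * c\<close> is the left derivative of \<open>F\<close> at 1. This is the quantity
  that the density bound has to control when \<open>\<theta> \<ge> 1\<close>.\<close>

locale perturbed_dickman =
  F: halfline_cdf F + G: halfline_cdf G for F G :: "real \<Rightarrow> real" +
  fixes \<theta> e c :: real
  assumes \<theta>: "0 < \<theta>" and e: "0 < e"
    and F_powr: "\<And>t. 0 \<le> t \<Longrightarrow> t \<le> 1 \<Longrightarrow> F t = c * t powr \<theta>"
    and F_eq: "\<And>t. 0 \<le> t \<Longrightarrow> t * F t = F.I t + \<theta> * (F.I t - F.I (t - 1))"
    and G_eq: "\<And>t. 0 \<le> t \<Longrightarrow> \<bar>t * G t - G.I t - \<theta> * (G.I t - G.I (t - 1))\<bar> \<le> e * G t"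
begin

definition H :: "real \<Rightarrow> real" where "H t = G t - F t"
definition K :: "real \<Rightarrow> real" where "K t = G.I t - F.I t"
definition r :: "real \<Rightarrow> real" where "r t = t * H t - K t - \<theta> * (K t - K (t - 1))"

lemma H_eq: "t * H t = K t + \<theta> * (K t - K (t - 1)) + r t"
  by (simp add: r_def)

lemma abs_H_le_1: "\<bar>H t\<bar> \<le> 1"
  using F.nonneg[of t] G.nonneg[of t] F.le_1[of t] G.le_1[of t] by (auto simp: H_def)

lemma r_bound: "0 \<le> t \<Longrightarrow> \<bar>r t\<bar> \<le> e * G t"
proof -
  assume "0 \<le> t"
  have "r t = t * G t - G.I t - \<theta> * (G.I t - G.I (t - 1))"
    using F_eq[OF \<open>0 \<le> t\<close>] by (simp add: r_def H_def K_def algebra_simps)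
  then show ?thesis using G_eq[OF \<open>0 \<le> t\<close>] by simp
qed

lemma r_le_e: "0 \<le> t \<Longrightarrow> \<bar>r t\<bar> \<le> e"
  using r_bound[of t] mult_left_mono[OF G.le_1[of t], of e] e by linarith

lemma K_neg: "t \<le> 0 \<Longrightarrow> K t = 0"
  by (simp add: K_def F.I_neg G.I_neg)

lemma continuous_on_K: "continuous_on {a..b} K"
  unfolding K_def by (intro continuous_intros F.continuous_on_I G.continuous_on_I)

lemma K_has_derivative:
  "0 \<le> t \<Longrightarrow> t < b \<Longrightarrow> (K has_real_derivative H t) (at t within {t..b})"
  unfolding K_def H_def
  by (intro derivative_intros F.I_has_derivative G.I_has_derivative)

text \<open>At infinity both \<open>t * H t\<close> and \<open>K t - K (t - 1)\<close> tend to 0, so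
  the equation leaves \<open>K t = - r t\<close> up to a vanishing term.\<close>

lemma K_limit:
  assumes "\<eta> > 0"
  shows "\<forall>\<^sub>F t in at_top. \<bar>K t\<bar> \<le> e + \<eta>"
proof -
  have shift: "filterlim (\<lambda>t::real. t - 1) at_top at_top"
    using filterlim_tendsto_add_at_top[OF tendsto_const[of "-1::real"] filterlim_ident] by simp
  have lim: "((\<lambda>t. t * (1 - F t) + t * (1 - G t)
      + \<theta> * ((1 - F (t - 1)) + (1 - G (t - 1)))) \<longlongrightarrow> 0 + 0 + \<theta> * ((1 - 1) + (1 - 1))) at_top"
    by (intro tendsto_intros F.tail G.tail filterlim_compose[OF F.lim_1 shift]
        filterlim_compose[OF G.lim_1 shift])
  then have "\<forall>\<^sub>F t in at_top. t * (1 - F t) + t * (1 - G t)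
      + \<theta> * ((1 - F (t - 1)) + (1 - G (t - 1))) < \<eta>"
    using assms by (intro order_tendstoD) auto
  then show ?thesis
    using eventually_ge_at_top[of 1]
  proof eventually_elim
    case (elim t)
    have "\<bar>t * H t\<bar> \<le> t * (1 - F t) + t * (1 - G t)"
    proof -
      have "t * H t = t * (1 - F t) - t * (1 - G t)" by (simp add: H_def algebra_simps)
      moreover have "t * (1 - F t) \<ge> 0" "t * (1 - G t) \<ge> 0"
        using elim F.le_1[of t] G.le_1[of t] by auto
      ultimately show ?thesis by linarith
    qed
    \<comment> \<open>Over a unit step \<open>F.I\<close> grows by a value between
      \<open>F (t - 1)\<close> and 1, and \<open>G.I\<close> by one between \<open>G (t - 1)\<close>
      and 1; both lower ends tend to 1.\<close>
    moreover have "\<bar>\<theta> * (K t - K (t - 1))\<bar> \<le> \<theta> * ((1 - F (t - 1)) + (1 - G (t - 1)))"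
      unfolding abs_mult using \<theta> F.I_increment_bounds[of t] G.I_increment_bounds[of t] elim
        F.le_1[of "t - 1"] G.le_1[of "t - 1"]
      by (intro mult_mono) (auto simp: K_def abs_le_iff)
    ultimately show ?case
      using elim H_eq[of t] r_le_e[of t] by linarith
  qed
qed

lemma signed_K_le:
  assumes s: "s = 1 \<or> s = -1" and t: "0 \<le> t"
  shows "s * K t \<le> e"
proof (rule field_le_epsilon)
  fix \<eta> :: real assume \<eta>: "\<eta> > 0"
  have "\<forall>\<^sub>F b in at_top. \<bar>K b\<bar> \<le> e + \<eta> \<and> t \<le> b"
    using K_limit[OF \<eta>] eventually_ge_at_top[of t] by eventually_elim auto
  then obtain b where b: "\<bar>K b\<bar> \<le> e + \<eta>" "t \<le> b"
    by (auto simp: eventually_at_top_linorder)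
  have "s * K t - (e + \<eta>) \<le> 0"
  proof (rule max_principle_right[of 0 b "\<lambda>t. s * K t - (e + \<eta>)"])
    show "continuous_on {0..b} (\<lambda>t. s * K t - (e + \<eta>))"
      by (intro continuous_intros continuous_on_K)
    show "s * K b - (e + \<eta>) \<le> 0" using s b by (auto simp: abs_le_iff)
    fix x assume x: "0 \<le> x" "x < b" "0 < s * K x - (e + \<eta>)"
      "\<And>y. 0 \<le> y \<Longrightarrow> y \<le> b \<Longrightarrow> s * K y - (e + \<eta>) \<le> s * K x - (e + \<eta>)"
    \<comment> \<open>For \<open>x \<ge> 1\<close> the point \<open>x - 1\<close> competes in the
      maximum, which is why the maximum must be global; for \<open>x < 1\<close> the value there is
      0.\<close>
    have "s * K (x - 1) \<le> s * K x"
      using x(4)[of "x - 1"] x(1-3) K_neg[of "x - 1"] e \<eta> by (cases "1 \<le> x") auto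
    then have "\<theta> * (s * K x - s * K (x - 1)) \<ge> 0" using \<theta> by simp
    moreover have "s * r x \<ge> - e" using s r_le_e[OF x(1)] by auto
    moreover have "x * (s * H x) = s * K x + \<theta> * (s * K x - s * K (x - 1)) + s * r x"
      using H_eq[of x] s by (auto simp: algebra_simps)
    ultimately have "x * (s * H x) > 0" using x(3) \<eta> by linarith
    then have "s * H x > 0" using x(1) by (metis linorder_not_less mult_nonneg_nonpos)
    moreover have "((\<lambda>t. s * K t - (e + \<eta>)) has_real_derivative s * H x) (at x within {x..b})"
      using K_has_derivative[OF x(1,2)] by (auto intro!: derivative_eq_intros)
    ultimately show "\<exists>D>0. ((\<lambda>t. s * K t - (e + \<eta>)) has_real_derivative D) (at x within {x..b})"
      by blast
  qed (use t b in auto)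
  then show "s * K t \<le> e + \<eta>" by simp
qed

lemma K_bound: "0 \<le> t \<Longrightarrow> \<bar>K t\<bar> \<le> e"
  using signed_K_le[of 1 t] signed_K_le[of "-1" t] by auto

text \<open>On the unit interval \<open>K (t - 1) = 0\<close>, so
  \<open>t * H t = (1 + \<theta>) * K t + r t\<close>, and \<open>G \<le> F + \<bar>H\<bar>\<close>
  gives \<open>\<bar>r t\<bar> \<le> e * (c * t powr \<theta> + h)\<close>. The right side \<phi> of
  the claim solves the equation with \<open>r\<close> replaced by minus this bound. Its homogeneous
  part \<open>e * t powr (1 + \<theta>)\<close> is scaled so that \<phi> dominates
  \<open>\<bar>K\<bar>\<close> at 1, where \<open>\<bar>K 1\<bar> \<le> e\<close> is already
  known.\<close>

lemma K_bound_unit: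
  assumes t0: "0 < t0" and c: "0 \<le> c"
    and h: "\<And>u. t0 \<le> u \<Longrightarrow> u \<le> 1 \<Longrightarrow> \<bar>H u\<bar> \<le> h" "0 \<le> h"
    and t: "t0 \<le> t" "t \<le> 1"
  shows "\<bar>K t\<bar> \<le> e * (t powr (1 + \<theta>) + c * t powr \<theta> + h / (1 + \<theta>))"
proof -
  define \<phi> where "\<phi> t = e * (t powr (1 + \<theta>) + c * t powr \<theta> + h / (1 + \<theta>))" for t
  have "s * K t - \<phi> t \<le> 0" if s: "s = 1 \<or> s = -1" for s
  proof (rule max_principle_right[of t0 1 "\<lambda>t. s * K t - \<phi> t"])
    show "continuous_on {t0..1} (\<lambda>t. s * K t - \<phi> t)"
      unfolding \<phi>_def using t0 by (intro continuous_intros continuous_on_K) auto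
    have "\<phi> 1 \<ge> e" unfolding \<phi>_def
      using e c h(2) \<theta> by (simp add: algebra_simps)
    then show "s * K 1 - \<phi> 1 \<le> 0" using signed_K_le[OF s, of 1] by simp
    fix x assume x: "t0 \<le> x" "x < 1" "0 < s * K x - \<phi> x"
    define D where "D = s * H x - e * ((1 + \<theta>) * x powr \<theta> + c * (\<theta> * x powr (\<theta> - 1)))"
    have x0: "x > 0" using x t0 by simp
    have xx: "x * x powr \<theta> = x powr (1 + \<theta>)" "x * x powr (\<theta> - 1) = x powr \<theta>"
      using x0 powr_add[of x 1 \<theta>] powr_add[of x 1 "\<theta> - 1"] by (simp_all del: powr_mult_base powr_add)
    have D: "x * D = x * (s * H x) - e * ((1 + \<theta>) * x powr (1 + \<theta>) + c * (\<theta> * x powr \<theta>))"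
      unfolding D_def xx[symmetric] by (simp add: algebra_simps)
    have "x * (s * H x) = s * (K x + \<theta> * K x + r x)"
      using H_eq[of x] K_neg[of "x - 1"] x by (simp add: mult.left_commute)
    then have "x * (s * H x) = (1 + \<theta>) * (s * K x) + s * r x"
      by (simp add: algebra_simps)
    moreover have "(1 + \<theta>) * (s * K x) > (1 + \<theta>) * \<phi> x" using x(3) \<theta> by simp
    moreover have "(1 + \<theta>) * \<phi> x = e * ((1 + \<theta>) * x powr (1 + \<theta>) + c * (\<theta> * x powr \<theta>))
        + e * (c * x powr \<theta> + h)"
      using \<theta> by (simp add: \<phi>_def field_simps)
    ultimately have 1: "x * D > e * (c * x powr \<theta> + h) + s * r x" using D by linarith
    have "\<bar>r x\<bar> \<le> e * G x" using r_bound x0 by simp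
    also have "\<dots> \<le> e * (c * x powr \<theta> + h)"
      using h(1)[of x] x F_powr[of x] x0 e by (intro mult_left_mono) (auto simp: H_def)
    finally have "x * D > 0" using 1 s by auto
    then have "D > 0" using x0 zero_less_mult_pos by blast
    moreover have "((\<lambda>t. s * K t - \<phi> t) has_real_derivative D) (at x within {x..1})"
      unfolding \<phi>_def D_def
      using K_has_derivative[of x 1] x0 x
        has_real_derivative_powr[OF x0, of "1 + \<theta>", THEN DERIV_subset, of "{x..1}"]
        has_real_derivative_powr[OF x0, of \<theta>, THEN DERIV_subset, of "{x..1}"]
      by (auto intro!: derivative_eq_intros)
    ultimately show "\<exists>D>0. ((\<lambda>t. s * K t - \<phi> t) has_real_derivative D) (at x within {x..1})"
      by blast
  qed (use t t0 in auto)
  from this[of 1] this[of "-1"] show ?thesis by (auto simp: \<phi>_def)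
qed

end

section \<open>Pointwise bounds on \<open>H\<close>\<close>

context perturbed_dickman
begin

text \<open>This is a self-improving estimate: the a priori bound \<open>h\<close> returns with the
  factor 1/4. It enters once through \<open>K_bound_unit\<close> and once through
  \<open>G \<le> F + h\<close> in the bound on \<open>r\<close>, each time as \<open>e * h\<close>;
  division by \<open>t \<ge> 8 * e\<close> makes the sum
  \<open>2 * e * h / t \<le> h / 4\<close>.\<close>

lemma H_bound_window:
  assumes c: "0 \<le> c" and t0: "8 * e \<le> t0" "t0 \<le> 1"
    and h: "\<And>u. t0 \<le> u \<Longrightarrow> u \<le> 1 \<Longrightarrow> \<bar>H u\<bar> \<le> h"
    and t: "t0 \<le> t" "t \<le> 1"
  shows "\<bar>H t\<bar> \<le> e * ((1 + \<theta>) * t powr \<theta> + (2 + \<theta>) * c * t powr (\<theta> - 1)) + h / 4"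
proof -
  have t': "0 < t" "8 * e \<le> t" "0 < t0" using e t0 t by auto
  have h0: "0 \<le> h" using h[of 1] t0 by auto
  have "\<bar>K t\<bar> \<le> e * (t powr (1 + \<theta>) + c * t powr \<theta> + h / (1 + \<theta>))"
    by (rule K_bound_unit[OF t'(3) c h h0 t])
  then have "(1 + \<theta>) * \<bar>K t\<bar> \<le> (1 + \<theta>) * (e * (t powr (1 + \<theta>) + c * t powr \<theta> + h / (1 + \<theta>)))"
    using \<theta> by (intro mult_left_mono) auto
  also have "\<dots> = e * ((1 + \<theta>) * t powr (1 + \<theta>) + (1 + \<theta>) * c * t powr \<theta> + h)"
    using \<theta> by (simp add: field_simps)
  finally have K: "(1 + \<theta>) * \<bar>K t\<bar> \<le> \<dots>" .
  have "\<bar>r t\<bar> \<le> e * G t" using r_bound t' by simp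
  also have "\<dots> \<le> e * (c * t powr \<theta> + h)"
    using h[OF t] F_powr[of t] t t' e by (intro mult_left_mono) (auto simp: H_def)
  finally have r: "\<bar>r t\<bar> \<le> \<dots>" .
  have "t * H t = (1 + \<theta>) * K t + r t"
    using H_eq[of t] K_neg[of "t - 1"] t by (simp add: algebra_simps)
  then have "\<bar>t * H t\<bar> \<le> (1 + \<theta>) * \<bar>K t\<bar> + \<bar>r t\<bar>"
    using abs_triangle_ineq[of "(1 + \<theta>) * K t" "r t"] \<theta> by (simp add: abs_mult)
  also have "\<dots> \<le> e * ((1 + \<theta>) * t powr (1 + \<theta>) + (1 + \<theta>) * c * t powr \<theta> + h) + e * (c * t powr \<theta> + h)"
    using K r by linarith
  also have "\<dots> = t * (e * ((1 + \<theta>) * t powr \<theta> + (2 + \<theta>) * c * t powr (\<theta> - 1))) + 2 * e * h"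
    using t' powr_add[of t 1 \<theta>] powr_add[of t 1 "\<theta> - 1"] by (simp add: algebra_simps)
  also have "2 * e * h \<le> t * (h / 4)"
    using mult_right_mono[OF t'(2) h0] by simp
  finally have "t * \<bar>H t\<bar> \<le> t * (e * ((1 + \<theta>) * t powr \<theta> + (2 + \<theta>) * c * t powr (\<theta> - 1)) + h / 4)"
    using t' by (simp add: abs_mult distrib_left)
  then show ?thesis using t' by simp
qed

text \<open>With \<open>h\<close> the supremum of \<open>\<bar>H\<bar>\<close> over the window,
  which is finite because \<open>\<bar>H\<bar> \<le> 1\<close>, the preceding estimate reads
  \<open>h \<le> A + h / 4\<close>; hence the factor 4/3. To the left of the window both
  \<open>F\<close> and \<open>G\<close> lie between 0 and their values at \<open>8 * e\<close>, and
  these are at most \<open>c * (8 * e) powr \<theta> + h\<close>.\<close>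

lemma H_bound_unit:
  assumes c: "0 \<le> c" and e8: "8 * e \<le> 1"
    and A: "\<And>t. 8 * e \<le> t \<Longrightarrow> t \<le> 1 \<Longrightarrow>
      e * ((1 + \<theta>) * t powr \<theta> + (2 + \<theta>) * c * t powr (\<theta> - 1)) \<le> A"
    and t: "0 \<le> t" "t \<le> 1"
  shows "\<bar>H t\<bar> \<le> c * (8 * e) powr \<theta> + 4 / 3 * A"
proof -
  define h where "h = (SUP t\<in>{8 * e..1}. \<bar>H t\<bar>)"
  have h: "\<bar>H u\<bar> \<le> h" if "8 * e \<le> u" "u \<le> 1" for u
    unfolding h_def
    by (rule cSUP_upper) (use that abs_H_le_1 in \<open>auto intro!: bdd_aboveI2\<close>)
  have "h \<le> A + h / 4"
    unfolding h_def
  proof (rule cSUP_least)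
    fix u assume "u \<in> {8 * e..1}"
    then show "\<bar>H u\<bar> \<le> A + (SUP t\<in>{8 * e..1}. \<bar>H t\<bar>) / 4"
      using H_bound_window[OF c order_refl e8 h, of u] A[of u] by (auto simp: h_def)
  qed (use e8 in auto)
  then have hA: "h \<le> 4 / 3 * A" by simp
  show ?thesis
  proof (cases "8 * e \<le> t")
    case True
    have "0 \<le> c * (8 * e) powr \<theta>" using c by simp
    then show ?thesis using h[OF True t(2)] hA by linarith
  next
    case False
    have "G t \<le> G (8 * e)" "F t \<le> F (8 * e)"
      using False monoD[OF G.mono] monoD[OF F.mono] by auto
    moreover have "F (8 * e) = c * (8 * e) powr \<theta>" using F_powr[of "8 * e"] e e8 by simp
    moreover have "G (8 * e) \<le> F (8 * e) + h" using h[of "8 * e"] e8 by (auto simp: H_def)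
    moreover have "0 \<le> h" using h[of 1] e8 by auto
    ultimately show ?thesis
      using hA G.nonneg[of t] F.nonneg[of t] unfolding H_def by linarith
  qed
qed

text \<open>The term \<open>K (t - 1)\<close> is kept because replacing it by \<open>e\<close> is
  too crude for \<open>1 \<le> t \<le> 2\<close> and \<open>\<theta> \<ge> 1\<close>; there
  \<open>K_bound_unit\<close> applies to it.\<close>

lemma H_bound_ge_1:
  assumes "1 \<le> t"
  shows "t * \<bar>H t\<bar> \<le> (1 + \<theta>) * e + \<theta> * \<bar>K (t - 1)\<bar> + e"
proof -
  have "\<bar>t * H t\<bar> \<le> \<bar>(1 + \<theta>) * K t\<bar> + \<bar>\<theta> * K (t - 1)\<bar> + \<bar>r t\<bar>"
    using H_eq[of t] by (simp add: algebra_simps)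
  moreover have "(1 + \<theta>) * \<bar>K t\<bar> \<le> (1 + \<theta>) * e"
    using K_bound[of t] assms \<theta> by (intro mult_left_mono) auto
  moreover have "\<bar>t * H t\<bar> = t * \<bar>H t\<bar>" "\<bar>(1 + \<theta>) * K t\<bar> = (1 + \<theta>) * \<bar>K t\<bar>"
    "\<bar>\<theta> * K (t - 1)\<bar> = \<theta> * \<bar>K (t - 1)\<bar>" "\<bar>r t\<bar> \<le> e"
    using r_le_e[of t] assms \<theta> by (simp_all add: abs_mult)
  ultimately show ?thesis by linarith
qed

lemma H_bound_theta_less_1:
  assumes "\<theta> < 1" "0 \<le> c" "0 \<le> t"
  shows "\<bar>H t\<bar> \<le> 2 * \<theta> * e + 3 * (6 * e) powr \<theta>"
proof (cases "8 * e \<le> 1")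
  case False
  \<comment> \<open>The claimed bound exceeds 1 here: \<open>6 * e > 3/4\<close>, so
    \<open>3 * (6 * e) powr \<theta>\<close> is at least 9/4.\<close>
  then have "(3/4) powr \<theta> \<le> (6 * e) powr \<theta>" using \<theta> by (intro powr_mono2) auto
  moreover have "(3/4) powr 1 \<le> (3/4) powr \<theta>" using assms \<theta> by (intro powr_mono') auto
  moreover have "0 \<le> 2 * \<theta> * e" using \<theta> e by simp
  ultimately show ?thesis using abs_H_le_1[of t] by simp
next
  case True
  have e6: "6 * e \<le> (6 * e) powr \<theta>"
    using powr_mono'[of \<theta> 1 "6 * e"] assms e True by simp
  have \<theta>e: "0 \<le> \<theta> * e" "\<theta> * e \<le> e" using assms \<theta> e by auto
  show ?thesis
  proof (cases "t \<le> 1")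
    case t1: True
    \<comment> \<open>Each power is taken at its worst point of the window:
      \<open>u powr \<theta>\<close> at 1, and the decreasing \<open>u powr (\<theta> - 1)\<close>
      at \<open>8 * e\<close>, where
      \<open>e * (8 * e) powr (\<theta> - 1) = (8 * e) powr \<theta> / 8\<close>.\<close>
    define A where "A = (1 + \<theta>) * e + (2 + \<theta>) / 8 * (8 * e) powr \<theta>"
    have c1: "c \<le> 1" using F_powr[of 1] F.le_1[of 1] by simp
    have "e * ((1 + \<theta>) * u powr \<theta> + (2 + \<theta>) * c * u powr (\<theta> - 1)) \<le> A"
      if u: "8 * e \<le> u" "u \<le> 1" for u
    proof -
      have "u powr \<theta> \<le> 1" using powr_mono2[of \<theta> u 1] u e \<theta> by simp
      moreover have "u powr (\<theta> - 1) \<le> (8 * e) powr (\<theta> - 1)"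
        using u e assms by (intro powr_mono2') auto
      ultimately have "(1 + \<theta>) * u powr \<theta> + (2 + \<theta>) * c * u powr (\<theta> - 1)
          \<le> (1 + \<theta>) * 1 + (2 + \<theta>) * 1 * (8 * e) powr (\<theta> - 1)"
        using c1 assms \<theta> by (intro add_mono mult_mono) auto
      then have "e * ((1 + \<theta>) * u powr \<theta> + (2 + \<theta>) * c * u powr (\<theta> - 1))
          \<le> e * ((1 + \<theta>) * 1 + (2 + \<theta>) * 1 * (8 * e) powr (\<theta> - 1))"
        using e by (intro mult_left_mono) auto
      also have "\<dots> = A"
        using e powr_add[of "8 * e" 1 "\<theta> - 1"] by (simp add: A_def algebra_simps)
      finally show ?thesis .
    qed
    from H_bound_unit[OF assms(2) True this assms(3) t1]
    have "\<bar>H t\<bar> \<le> c * (8 * e) powr \<theta> + 4 / 3 * A" by blast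
    moreover have "c * (8 * e) powr \<theta> \<le> (8 * e) powr \<theta>"
      using c1 mult_right_mono[of c 1 "(8 * e) powr \<theta>"] by simp
    moreover have "(8 * e) powr \<theta> \<le> 4 / 3 * (6 * e) powr \<theta>"
    proof -
      have "(8 * e) powr \<theta> = (4/3) powr \<theta> * (6 * e) powr \<theta>"
        using e by (simp add: powr_mult[symmetric])
      also have "\<dots> \<le> 4/3 * (6 * e) powr \<theta>"
        using powr_mono[of \<theta> 1 "4/3"] assms by (intro mult_right_mono) auto
      finally show ?thesis .
    qed
    moreover have "\<theta> * (8 * e) powr \<theta> \<le> (8 * e) powr \<theta>"
      using assms mult_right_mono[of \<theta> 1 "(8 * e) powr \<theta>"] by simp
    \<comment> \<open>The terms in \<open>(8 * e) powr \<theta>\<close> add up to at most 3/2 of it,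
      hence to at most \<open>2 * (6 * e) powr \<theta>\<close>. The term \<open>4 / 3 * e\<close>
      costs a further 2/9 of \<open>(6 * e) powr \<theta>\<close>, and
      \<open>4 / 3 * (\<theta> * e)\<close> is covered by \<open>2 * \<theta> * e\<close>.\<close>
    moreover have "4 / 3 * A = 4 / 3 * e + 4 / 3 * (\<theta> * e) + (8 * e) powr \<theta> / 3 + \<theta> * (8 * e) powr \<theta> / 6"
      by (simp add: A_def field_simps)
    ultimately show ?thesis
      using e6 \<theta>e by linarith
  next
    case False
    then have t1: "1 \<le> t" by simp
    have "\<theta> * \<bar>K (t - 1)\<bar> \<le> \<theta> * e" using K_bound[of "t - 1"] t1 \<theta> by (intro mult_left_mono) auto
    moreover have "\<bar>H t\<bar> \<le> t * \<bar>H t\<bar>" using t1 mult_right_mono[of 1 t "\<bar>H t\<bar>"] by simp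
    ultimately show ?thesis using H_bound_ge_1[OF t1] e6 \<theta>e e by (simp add: algebra_simps)
  qed
qed

text \<open>The target contains no absolute constant beside \<theta> and \<open>k\<close>, although
  the estimates produce some. They are paid for through \<open>1 \<le> 2 * \<theta> * k\<close>,
  which prevents \<theta> and \<open>k\<close> from being small together.\<close>

lemma H_bound_theta_ge_1:
  assumes \<theta>1: "1 \<le> \<theta>" and c: "0 \<le> c" "\<theta> * c \<le> k" and k: "1 \<le> 2 * \<theta> * k" and t: "0 \<le> t"
  shows "\<bar>H t\<bar> \<le> e * (2 * \<theta> + 16 * k)"
proof (cases "e * (2 * \<theta> + 16 * k) \<le> 1")
  case False
  then show ?thesis using abs_H_le_1[of t] by simp
next
  case e1: True
  define B where "B = e * (2 * \<theta> + 16 * k)"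
  have k0: "1 / (2 * \<theta>) \<le> k" using k \<theta> by (simp add: field_simps)
  \<comment> \<open>As \<open>k \<ge> 1 / (2 * \<theta>)\<close>, the right side is at least
    \<open>\<theta> / a + a / \<theta>\<close>. The free parameter \<open>a\<close> sets the
    exchange rate between \<theta> and \<open>k\<close>; the values 1, 3/2 and 2 are used
    below.\<close>
  have amgm: "2 \<le> \<theta> / a + 2 * a * k" if a: "0 < a" for a
  proof -
    have "\<theta> / a + 2 * a * (1 / (2 * \<theta>)) \<ge> 2"
    proof -
      have "\<theta> / a + a / \<theta> - 2 = (\<theta> - a)\<^sup>2 / (a * \<theta>)"
        using a \<theta> by (simp add: field_simps power2_eq_square)
      also have "\<dots> \<ge> 0" using a \<theta> by simp
      finally show ?thesis by simp
    qed
    moreover have "2 * a * (1 / (2 * \<theta>)) \<le> 2 * a * k" using k0 a by (intro mult_left_mono) auto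
    ultimately show ?thesis by linarith
  qed
  have kpos: "k > 0" using k0 \<theta> by (meson less_le_trans divide_pos_pos mult_pos_pos zero_less_one zero_less_numeral)
  have "8 \<le> 2 * \<theta> + 16 * k" using amgm[of 2] by simp
  then have e8: "8 * e \<le> 1" using e1 mult_left_mono[of 8 "2 * \<theta> + 16 * k" e] e by linarith
  have c3: "(2 + \<theta>) * c \<le> 3 * k"
    using mult_right_mono[of "2 + \<theta>" "3 * \<theta>" c] \<theta>1 c by simp
  have ck: "c \<le> k" using mult_right_mono[OF \<theta>1 c(1)] c(2) by simp
  have H1: "\<bar>H u\<bar> \<le> B" if u: "0 \<le> u" "u \<le> 1" for u
  proof -
    define A where "A = e * (1 + \<theta> + 3 * k)"
    have "e * ((1 + \<theta>) * v powr \<theta> + (2 + \<theta>) * c * v powr (\<theta> - 1)) \<le> A"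
      if v: "8 * e \<le> v" "v \<le> 1" for v
    proof -
      have "v powr \<theta> \<le> 1" "v powr (\<theta> - 1) \<le> 1"
        using powr_mono2[of \<theta> v 1] powr_mono2[of "\<theta> - 1" v 1] v e \<theta>1 by auto
      then have "(1 + \<theta>) * v powr \<theta> + ((2 + \<theta>) * c) * v powr (\<theta> - 1) \<le> (1 + \<theta>) * 1 + (3 * k) * 1"
        using c kpos \<theta> by (intro add_mono[OF mult_mono mult_mono[OF c3]]) auto
      then show ?thesis unfolding A_def using e by (intro mult_left_mono) auto
    qed
    from H_bound_unit[OF c(1) e8 this u]
    have "\<bar>H u\<bar> \<le> c * (8 * e) powr \<theta> + 4 / 3 * A" by blast
    moreover have "c * (8 * e) powr \<theta> \<le> k * (8 * e)"
    proof (rule mult_mono[OF ck])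
      show "(8 * e) powr \<theta> \<le> 8 * e"
        using powr_mono'[of 1 \<theta> "8 * e"] \<theta>1 e e8 by simp
    qed (use kpos in auto)
    \<comment> \<open>The bounds so far sum to \<open>e * (4/3 + 4/3 * \<theta> + 12 * k)\<close>;
      the constant 4/3 has to fit into what remains of \<open>2 * \<theta> + 16 * k\<close>.\<close>
    moreover have "4 / 3 \<le> 2 / 3 * \<theta> + 4 * k" using amgm[of "3/2"] kpos by simp
    then have "e * (4 / 3) \<le> e * (2 / 3 * \<theta> + 4 * k)" using e by (intro mult_left_mono) auto
    ultimately show ?thesis by (simp add: A_def B_def algebra_simps)
  qed
  consider "t \<le> 1" | "1 \<le> t" "t \<le> 2" | "2 \<le> t" by linarith
  then show ?thesis
  proof cases
    case 1
    then show ?thesis using H1[OF t] by (simp add: B_def)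
  next
    case 3
    have "\<theta> * \<bar>K (t - 1)\<bar> \<le> \<theta> * e" using K_bound[of "t - 1"] 3 \<theta> by (intro mult_left_mono) auto
    moreover have "2 * \<bar>H t\<bar> \<le> t * \<bar>H t\<bar>" using 3 by (intro mult_right_mono) auto
    ultimately have "\<bar>H t\<bar> \<le> e * (1 + \<theta>)" using H_bound_ge_1[of t] 3 by (simp add: algebra_simps)
    also have "\<dots> \<le> e * (2 * \<theta> + 16 * k)" using \<theta>1 kpos e by (intro mult_left_mono) auto
    finally show ?thesis .
  next
    \<comment> \<open>Using \<open>\<bar>K (t - 1)\<bar> \<le> e\<close> would leave
      \<open>e * (2 + 2 * \<theta>)\<close> at \<open>t = 1\<close>, too much if
      \<open>k < 1/8\<close>. Since \<open>H\<close> is already bounded by \<open>B \<le> 1\<close>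
      on the unit interval, \<open>K_bound_unit\<close> replaces the contribution \<theta> of
      \<open>K (t - 1)\<close> by \<open>\<theta> * u\<^sup>2 + k + 1\<close>, and the factor
      \<open>t = 1 + u\<close> on the left pays for the quadratic term.\<close>
    case 2
    define u where "u = t - 1"
    have u: "0 \<le> u" "u \<le> 1" using 2 by (auto simp: u_def)
    have "\<theta> * \<bar>K u\<bar> \<le> e * (\<theta> * u\<^sup>2 + k + 1)"
    proof (cases "u = 0")
      case True
      then show ?thesis using kpos e by (simp add: K_neg)
    next
      case False
      have B0: "0 \<le> B" using H1[of 0] by auto
      have "\<bar>K u\<bar> \<le> e * (u powr (1 + \<theta>) + c * u powr \<theta> + B / (1 + \<theta>))"
        by (rule K_bound_unit[of u]) (use u False H1 B0 c in auto)
      then have "\<theta> * \<bar>K u\<bar> \<le> \<theta> * (e * (u powr (1 + \<theta>) + c * u powr \<theta> + B / (1 + \<theta>)))"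
        using \<theta> by (intro mult_left_mono) auto
      also have "\<dots> = e * (\<theta> * u powr (1 + \<theta>) + \<theta> * c * u powr \<theta> + B * (\<theta> / (1 + \<theta>)))"
        by (simp add: algebra_simps)
      also have "\<dots> \<le> e * (\<theta> * u\<^sup>2 + k * 1 + 1 * 1)"
      proof -
        have "u powr (1 + \<theta>) \<le> u\<^sup>2"
          using powr_mono'[of 2 "1 + \<theta>" u] \<theta>1 u False by simp
        moreover have "u powr \<theta> \<le> 1" using powr_mono2[of \<theta> u 1] u \<theta> by simp
        moreover have "B \<le> 1" using e1 by (simp add: B_def)
        moreover have "\<theta> / (1 + \<theta>) \<le> 1" using \<theta> by simp
        ultimately show ?thesis
          using e c kpos \<theta> by (intro mult_left_mono add_mono mult_mono) auto
      qed
      finally show ?thesis by simp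
    qed
    moreover have "t * \<bar>H t\<bar> \<le> (1 + \<theta>) * e + \<theta> * \<bar>K u\<bar> + e"
      using H_bound_ge_1[OF 2(1)] by (simp add: u_def)
    ultimately have "t * \<bar>H t\<bar> \<le> e * (3 + \<theta> + \<theta> * u\<^sup>2 + k)" by (simp add: algebra_simps)
    also have "\<dots> \<le> e * (t * (2 * \<theta> + 16 * k))"
    proof (rule mult_left_mono)
      have "t * (16 * k) \<ge> 1 * (16 * k)" using 2 kpos by (intro mult_right_mono) auto
      moreover have "\<theta> * u\<^sup>2 \<le> \<theta> * (2 * u)"
      proof -
        have "u\<^sup>2 \<le> 2 * u" using mult_right_mono[of u 2 u] u by (simp add: power2_eq_square)
        then show ?thesis using \<theta> by simp
      qed
      moreover have "3 \<le> \<theta> + 15 * k" using amgm[of 2] amgm[of 1] kpos \<theta>1 by simp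
      ultimately show "3 + \<theta> + \<theta> * u\<^sup>2 + k \<le> t * (2 * \<theta> + 16 * k)"
        by (simp add: u_def algebra_simps)
    qed (use e in auto)
    finally have "t * \<bar>H t\<bar> \<le> t * (e * (2 * \<theta> + 16 * k))" by (simp add: algebra_simps)
    then show ?thesis using 2 by simp
  qed
qed

end

section \<open>Lower bound on \<open>\<theta> * k\<close>\<close>

context halfline_cdf
begin

text \<open>The equation forces the mean to be \<open>\<theta>\<close>, and a law with density at most \<open>k\<close> has mean at least \<open>1 / (2 k)\<close>.\<close>

lemma slope_bound_ge:
  assumes \<theta>: "0 < \<theta>" and k: "0 < k" and Fk: "\<And>x. 0 \<le> x \<Longrightarrow> F x \<le> k * x"
    and F_eq: "\<And>t. 0 \<le> t \<Longrightarrow> t * F t = I t + \<theta> * (I t - I (t - 1))"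
  shows "1 \<le> 2 * \<theta> * k"
proof -
  \<comment> \<open>\<open>F\<close> stays below both \<open>k * x\<close> and 1; the triangle cut
    off from height 1 has area \<open>1 / (2 * k)\<close>.\<close>
  have I: "I t \<le> t - 1 / (2 * k)" if "1 / k \<le> t" for t
  proof -
    have k': "0 \<le> 1 / k" using k by simp
    have "I (1 / k) \<le> integral {0..1 / k} (\<lambda>x. k * x)"
      unfolding I_def by (rule integral_le[OF integrable]) (auto intro!: integrable_continuous_interval continuous_intros Fk)
    also have "\<dots> = 1 / (2 * k)"
    proof -
      have "((\<lambda>x. k * x) has_integral (k * (1 / k)\<^sup>2 / 2 - k * 0\<^sup>2 / 2)) {0..1 / k}"
        by (rule fundamental_theorem_of_calculus[OF k'])
           (auto intro!: derivative_eq_intros simp: has_real_derivative_iff_has_vector_derivative[symmetric])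
      then show ?thesis using k by (simp add: integral_unique field_simps power2_eq_square)
    qed
    finally have "I (1 / k) \<le> 1 / (2 * k)" .
    moreover have "I t - I (1 / k) \<le> (t - 1 / k) * F t"
      using I_diff_bounds(2)[OF k' that] .
    moreover have "(t - 1 / k) * F t \<le> t - 1 / k"
      using mult_left_mono[OF le_1[of t], of "t - 1 / k"] that by simp
    moreover have "1 / k = 2 * (1 / (2 * k))" by simp
    ultimately show ?thesis by linarith
  qed
  \<comment> \<open>By the equation \<open>t * (1 - F t) + \<theta>\<close> is at least
    \<open>t - I t\<close>, the truncated mean, and by \<open>tail\<close> it tends to
    \<theta>.\<close>
  have "1 / (2 * k) \<le> \<theta>"
  proof (rule tendsto_lowerbound)
    show "((\<lambda>t. t * (1 - F t) + \<theta>) \<longlongrightarrow> \<theta>) at_top"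
      using tendsto_add[OF tail tendsto_const[of \<theta>]] by simp
    show "\<forall>\<^sub>F t in at_top. 1 / (2 * k) \<le> t * (1 - F t) + \<theta>"
      using eventually_ge_at_top[of "1 / k"] eventually_ge_at_top[of 1]
    proof eventually_elim
      case (elim t)
      have "\<theta> * (I t - I (t - 1)) \<le> \<theta> * 1"
        using I_increment_bounds(2)[of t] elim \<theta> by (intro mult_left_mono) auto
      then show ?case using I[of t] F_eq[of t] elim by (simp add: algebra_simps)
    qed
  qed simp
  then show ?thesis using k by (simp add: field_simps)
qed

end

section \<open>Distribution function of the Dickman law\<close>

locale nonneg_law = real_distribution N for N :: "real measure" +
  assumes AE_nonneg: "AE x in N. 0 \<le> x"
begin

lemma cdf_neg: "t < 0 \<Longrightarrow> cdf N t = 0"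
proof -
  assume "t < 0"
  have "AE x in N. x \<notin> {..t}" using AE_nonneg by eventually_elim (use \<open>t < 0\<close> in auto)
  then have "measure N {..t} = 0"
    using AE_iff_null_sets[of "{..t}" N] by (intro measure_eq_0_null_sets) simp
  then show ?thesis by (simp add: cdf_def)
qed

lemma mono_cdf: "mono (cdf N)"
  by (intro monoI cdf_nondecreasing)

lemma borel_measurable_cdf [measurable]: "cdf N \<in> borel_measurable borel"
  by (rule borel_measurable_mono[OF mono_cdf])

lemma integrable_truncated: "integrable N (\<lambda>x. max 0 (t - x))"
  using AE_nonneg
  by (intro integrable_const_bound[where B="max 0 t"]) (auto elim!: eventually_mono)

text \<open>This is Fubini on the region \<open>x \<le> s \<le> t\<close>. It covers negative
  \<open>t\<close> as well, so it applies to the shifted argument \<open>t - 1\<close>.\<close>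

lemma integral_cdf: "integral {0..t} (cdf N) = (\<integral>x. max 0 (t - x) \<partial>N)"
proof (cases "0 \<le> t")
  case False
  have "AE x in N. max 0 (t - x) = 0"
    using AE_nonneg by eventually_elim (use False in auto)
  then have "(\<integral>x. max 0 (t - x) \<partial>N) = (\<integral>x. 0 \<partial>N)" by (intro integral_cong_AE) auto
  with False show ?thesis by simp
next
  case True
  have int: "cdf N integrable_on {0..t}"
    using mono_cdf integrable_on_mono_on mono_imp_mono_on by blast
  have ge0: "0 \<le> integral {0..t} (cdf N)"
    by (rule integral_nonneg[OF int]) (simp add: cdf_nonneg)
  interpret P: pair_sigma_finite N lborel by standard
  have "((\<lambda>s. if s \<in> {0..t} then cdf N s else 0) has_integral integral {0..t} (cdf N)) UNIV"
    using int by (simp only: has_integral_restrict_UNIV integrable_integral)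
  then have "ennreal (integral {0..t} (cdf N)) = (\<integral>\<^sup>+s. ennreal (if s \<in> {0..t} then cdf N s else 0) \<partial>lborel)"
    by (intro nn_integral_has_integral_lborel[symmetric]) (auto simp: cdf_nonneg)
  also have "\<dots> = (\<integral>\<^sup>+s. (\<integral>\<^sup>+x. indicator {0..t} s * indicator {..s} x \<partial>N) \<partial>lborel)"
    by (intro nn_integral_cong)
       (auto simp: nn_integral_cmult emeasure_eq_measure cdf_def indicator_def[of "{0..t}"])
  also have "\<dots> = (\<integral>\<^sup>+x. (\<integral>\<^sup>+s. indicator {0..t} s * indicator {..s} x \<partial>lborel) \<partial>N)"
  proof (rule P.Fubini')
    have "(\<lambda>(x, s). indicator {0..t} s * (if x \<le> s then 1 else 0 :: ennreal))
        \<in> borel_measurable (N \<Otimes>\<^sub>M lborel)" by measurable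
    then show "(\<lambda>(x, s). indicator {0..t} s * indicator {..s} x :: ennreal)
        \<in> borel_measurable (N \<Otimes>\<^sub>M lborel)"
      by (simp add: indicator_def[of "{..s}" for s] atMost_iff)
  qed
  also have "\<dots> = (\<integral>\<^sup>+x. ennreal (max 0 (t - x)) \<partial>N)"
  proof (rule nn_integral_cong_AE)
    show "AE x in N. (\<integral>\<^sup>+s. indicator {0..t} s * indicator {..s} x \<partial>lborel) = ennreal (max 0 (t - x))"
      using AE_nonneg
    proof eventually_elim
      case (elim x)
      have "(\<integral>\<^sup>+s. indicator {0..t} s * indicator {..s} x \<partial>lborel) = (\<integral>\<^sup>+s. indicator {x..t} s \<partial>lborel)"
        using elim by (intro nn_integral_cong) (auto simp: indicator_def)
      also have "\<dots> = ennreal (max 0 (t - x))"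
        by (cases "x \<le> t") auto
      finally show ?case .
    qed
  qed
  also have "\<dots> = ennreal (\<integral>x. max 0 (t - x) \<partial>N)"
    by (rule nn_integral_eq_integral[OF integrable_truncated]) auto
  finally show ?thesis using ge0 by (simp add: integral_nonneg_AE)
qed

lemma integrable_below: "integrable N (\<lambda>x. x * indicator {..t} x)"
  using AE_nonneg
  by (intro integrable_const_bound[where B="max 0 t"])
     (auto elim!: eventually_mono split: split_indicator)

text \<open>The left side is what a size-bias identity evaluates for the indicator of
  \<open>{..t}\<close>; the right side is the form in which it enters the integral equation.\<close>

lemma integral_below: "(\<integral>x. x * indicator {..t} x \<partial>N) = t * cdf N t - integral {0..t} (cdf N)"
proof -
  have "(\<integral>x. x * indicator {..t} x \<partial>N) = (\<integral>x. t * indicator {..t} x - max 0 (t - x) \<partial>N)"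
    by (intro Bochner_Integration.integral_cong) (auto split: split_indicator)
  also have "\<dots> = t * cdf N t - integral {0..t} (cdf N)"
    by (subst Bochner_Integration.integral_diff)
       (auto simp: integrable_truncated integral_cdf[unfolded cdf_def] cdf_def emeasure_eq_measure
         intro!: integrable_mult_right integrable_real_indicator)
  finally show ?thesis .
qed

lemma halfline_cdf_cdf:
  assumes "integrable N (\<lambda>x. x)"
  shows "halfline_cdf (cdf N)"
proof
  show "mono (cdf N)" by (rule mono_cdf)
  show "continuous (at_right t) (cdf N)" for t by (rule cdf_is_right_cont)
  show "cdf N t = 0" if "t < 0" for t by (rule cdf_neg[OF that])
  show "cdf N t \<le> 1" for t by (rule cdf_bounded_prob)
  show "((\<lambda>t. t * (1 - cdf N t)) \<longlongrightarrow> 0) at_top"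
  proof (rule tendsto_sandwich[OF _ _ tendsto_const])
    have "((\<lambda>t. \<integral>x. x * indicator {t<..} x \<partial>N) \<longlongrightarrow> (\<integral>x. 0 \<partial>N)) at_top"
    proof (rule integral_dominated_convergence_at_top[where w="\<lambda>x. \<bar>x\<bar>"])
      show "\<forall>\<^sub>F t in at_top. AE x in N. norm (x * indicator {t<..} x) \<le> \<bar>x\<bar>"
        by (intro always_eventually allI AE_I2) (simp split: split_indicator)
      show "AE x in N. ((\<lambda>t. x * indicator {t<..} x) \<longlongrightarrow> 0) at_top"
      proof (rule AE_I2)
        fix x :: real
        have "\<forall>\<^sub>F t in at_top. x * indicator {t<..} x = 0"
          using eventually_ge_at_top[of x] by eventually_elim auto
        then show "((\<lambda>t. x * indicator {t<..} x) \<longlongrightarrow> 0) at_top"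
          by (rule tendsto_eventually)
      qed
      show "integrable N (\<lambda>x. \<bar>x\<bar>)" using assms by simp
    qed measurable
    then show "((\<lambda>t. \<integral>x. x * indicator {t<..} x \<partial>N) \<longlongrightarrow> 0) at_top" by simp
    show "\<forall>\<^sub>F t in at_top. 0 \<le> t * (1 - cdf N t)"
      using eventually_ge_at_top[of 0] by eventually_elim (simp add: cdf_bounded_prob)
    show "\<forall>\<^sub>F t in at_top. t * (1 - cdf N t) \<le> (\<integral>x. x * indicator {t<..} x \<partial>N)"
    proof (intro always_eventually allI)
      fix t
      have "1 - cdf N t = prob (space N - {..t})" by (subst prob_compl) (auto simp: cdf_def)
      also have "space N - {..t} = {t<..}" by auto
      finally have "t * (1 - cdf N t) = (\<integral>x. t * indicator {t<..} x \<partial>N)" by simp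
      also have "\<dots> \<le> (\<integral>x. x * indicator {t<..} x \<partial>N)"
      proof (rule integral_mono)
        show "integrable N (\<lambda>x. x * indicator {t<..} x)"
          by (rule integrable_real_mult_indicator[OF _ assms]) simp
        show "t * indicator {t<..} x \<le> x * indicator {t<..} x" for x
          by (simp split: split_indicator)
      qed (auto intro!: integrable_mult_right integrable_real_indicator simp: emeasure_eq_measure)
      finally show "t * (1 - cdf N t) \<le> (\<integral>x. x * indicator {t<..} x \<partial>N)" .
    qed
  qed
qed

end

lemma integral_uniform_unit:
  fixes f :: "real \<Rightarrow> real"
  assumes [measurable]: "f \<in> borel_measurable borel"
  shows "(\<integral>u. f u \<partial>uniform_measure lborel {0..1}) = (LINT u:{0..1}|lborel. f u)"
proof -
  have "uniform_measure lborel {0..1::real} = density lborel (\<lambda>u. ennreal (indicator {0..1} u))"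
    unfolding uniform_measure_def by (simp add: ennreal_indicator divide_ennreal_def)
  then show ?thesis
    by (simp add: integral_density set_lebesgue_integral_def)
qed

lemma powr_inverse_mult_le_iff:
  fixes u t b \<theta> :: real
  assumes "0 \<le> u" "0 \<le> t" "0 < b" "0 < \<theta>"
  shows "u powr (1 / \<theta>) * b \<le> t \<longleftrightarrow> u \<le> (t / b) powr \<theta>"
proof -
  have "u powr (1 / \<theta>) * b \<le> t \<longleftrightarrow> u powr (1 / \<theta>) \<le> t / b" using assms by (simp add: field_simps)
  also have "\<dots> \<longleftrightarrow> (u powr (1 / \<theta>)) powr \<theta> \<le> (t / b) powr \<theta>"
  proof
    show "u powr (1 / \<theta>) \<le> t / b \<Longrightarrow> (u powr (1 / \<theta>)) powr \<theta> \<le> (t / b) powr \<theta>"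
      using assms by (intro powr_mono2) auto
    show "(u powr (1 / \<theta>)) powr \<theta> \<le> (t / b) powr \<theta> \<Longrightarrow> u powr (1 / \<theta>) \<le> t / b"
      using assms powr_less_mono2[of \<theta> "t / b" "u powr (1 / \<theta>)"] by fastforce
  qed
  also have "(u powr (1 / \<theta>)) powr \<theta> = u" using assms by (simp add: powr_powr)
  finally show ?thesis .
qed

section \<open>Consequences of the Dickman fixed-point equation\<close>

locale dickman =
  fixes \<theta> :: real and \<nu> :: "real measure"
  assumes \<theta>: "0 < \<theta>" and law: "dickman_law \<theta> \<nu>"
begin

sublocale nonneg_law \<nu>
proof -
  interpret prob_space \<nu> using law by (simp add: dickman_law_def)
  show "nonneg_law \<nu>"
    by unfold_locales (use law in \<open>auto simp: dickman_law_def\<close>)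
qed

lemma integral_fixpoint:
  fixes g :: "real \<Rightarrow> real"
  assumes [measurable]: "g \<in> borel_measurable borel" and B: "\<And>x. \<bar>g x\<bar> \<le> B"
  shows "(\<integral>x. g x \<partial>\<nu>) = (\<integral>d. (LINT u:{0..1}|lborel. g (u powr (1 / \<theta>) * (d + 1))) \<partial>\<nu>)"
proof -
  let ?U = "uniform_measure lborel {0..1::real}"
  interpret U: prob_space ?U by (rule prob_space_uniform_measure) auto
  interpret P: pair_prob_space ?U \<nu> ..
  let ?f = "\<lambda>(u, d). u powr (1 / \<theta>) * (d + 1)"
  have "(\<integral>x. g x \<partial>\<nu>) = (\<integral>x. g x \<partial>distr (?U \<Otimes>\<^sub>M \<nu>) borel ?f)"
    using law by (simp add: dickman_law_def)
  also have "\<dots> = (\<integral>z. g (?f z) \<partial>(?U \<Otimes>\<^sub>M \<nu>))"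
    by (rule integral_distr) measurable
  also have "\<dots> = (\<integral>z. (\<lambda>(u, d). g (u powr (1 / \<theta>) * (d + 1))) z \<partial>(?U \<Otimes>\<^sub>M \<nu>))"
    by (intro Bochner_Integration.integral_cong) auto
  also have "\<dots> = (\<integral>d. (\<integral>u. g (u powr (1 / \<theta>) * (d + 1)) \<partial>?U) \<partial>\<nu>)"
  proof (rule P.integral_snd[symmetric], rule P.integrable_const_bound[where B=B])
    show "(\<lambda>(u, d). g (u powr (1 / \<theta>) * (d + 1))) \<in> borel_measurable (?U \<Otimes>\<^sub>M \<nu>)" by measurable
  qed (use B in auto)
  also have "\<dots> = (\<integral>d. (LINT u:{0..1}|lborel. g (u powr (1 / \<theta>) * (d + 1))) \<partial>\<nu>)"
    by (intro Bochner_Integration.integral_cong refl integral_uniform_unit) measurable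
  finally show ?thesis .
qed

text \<open>For \<open>t \<le> 1 \<le> d + 1\<close> the threshold
  \<open>(t / (d + 1)) powr \<theta>\<close> for the uniform variable lies in the unit interval, so
  it is also the probability of staying below it. It factors into \<open>t powr \<theta>\<close> and
  a function of \<open>d\<close>, whose mean is identified by \<open>t = 1\<close>.\<close>

lemma cdf_powr:
  assumes "0 \<le> t" "t \<le> 1"
  shows "cdf \<nu> t = cdf \<nu> 1 * t powr \<theta>"
proof -
  have *: "cdf \<nu> t = (\<integral>d. (d + 1) powr (- \<theta>) \<partial>\<nu>) * t powr \<theta>" if t: "0 \<le> t" "t \<le> 1" for t
  proof -
    have "cdf \<nu> t = (\<integral>x. indicator {..t} x \<partial>\<nu>)" by (simp add: cdf_def)
    also have "\<dots> = (\<integral>d. (LINT u:{0..1}|lborel. indicator {..t} (u powr (1 / \<theta>) * (d + 1))) \<partial>\<nu>)"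
      by (rule integral_fixpoint[where B=1]) (auto split: split_indicator)
    also have "\<dots> = (\<integral>d. (d + 1) powr (- \<theta>) * t powr \<theta> \<partial>\<nu>)"
    proof (rule integral_cong_AE)
      show "AE d in \<nu>. (LINT u:{0..1}|lborel. indicator {..t} (u powr (1 / \<theta>) * (d + 1)))
          = (d + 1) powr (- \<theta>) * t powr \<theta>"
        using AE_nonneg
      proof eventually_elim
        case (elim d)
        have le1: "(t / (d + 1)) powr \<theta> \<le> 1"
          using powr_mono2[of \<theta> "t / (d + 1)" 1] elim t \<theta> by (simp add: field_simps)
        have "(LINT u:{0..1}|lborel. indicator {..t} (u powr (1 / \<theta>) * (d + 1)))
            = (LINT u|lborel. indicator {0..(t / (d + 1)) powr \<theta>} u)"
          unfolding set_lebesgue_integral_def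
          using powr_inverse_mult_le_iff[of _ t "d + 1" \<theta>] elim t \<theta> le1
          by (intro Bochner_Integration.integral_cong) (auto split: split_indicator)
        also have "\<dots> = (t / (d + 1)) powr \<theta>" by simp
        also have "\<dots> = (d + 1) powr (- \<theta>) * t powr \<theta>"
          using elim t by (simp add: powr_divide powr_minus field_simps)
        finally show ?case .
      qed
    qed (unfold set_lebesgue_integral_def, measurable)
    finally show ?thesis by simp
  qed
  from *[of 1] *[OF assms] show ?thesis by simp
qed

text \<open>The primitive of the linear integrand is
  \<open>f0 u = \<theta> * u * (b * u powr (1 / \<theta>) - t)\<close>. It vanishes exactly where
  the cutoff at \<open>t\<close> is reached, so nothing remains for \<open>b > t\<close>; for
  \<open>b \<le> t\<close> the cutoff does not occur before \<open>u = 1\<close>, and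
  \<open>f0 1 = - \<theta> * (t - b)\<close> remains.\<close>

lemma integral_scaled_unit:
  assumes t: "0 \<le> t" and b: "0 < b"
  shows "(LINT u:{0..1}|lborel. (if 0 \<le> u powr (1 / \<theta>) * b \<and> u powr (1 / \<theta>) * b \<le> t
      then (1 + \<theta>) * (u powr (1 / \<theta>) * b) - \<theta> * t else 0)) = - \<theta> * max 0 (t - b)"
proof -
  define a where "a = min 1 ((t / b) powr \<theta>)"
  have a: "0 \<le> a" "a \<le> 1" by (auto simp: a_def)
  have cont_powr: "continuous_on {0..a} (\<lambda>u. u powr q)" if "0 < q" for q :: real
    using that by (intro continuous_on_powr') auto
  define f where "f u = (1 + \<theta>) * (u powr (1 / \<theta>) * b) - \<theta> * t" for u :: real
  define f0 where "f0 u = \<theta> * b * u powr (1 + 1 / \<theta>) - \<theta> * t * u" for u :: real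
  have "(LINT u:{0..1}|lborel. (if 0 \<le> u powr (1 / \<theta>) * b \<and> u powr (1 / \<theta>) * b \<le> t
      then f u else 0)) = (LINT u:{0..a}|lborel. f u)"
    unfolding set_lebesgue_integral_def
  proof (rule Bochner_Integration.integral_cong)
    fix u :: real
    show "indicator {0..1} u *\<^sub>R (if 0 \<le> u powr (1 / \<theta>) * b \<and> u powr (1 / \<theta>) * b \<le> t then f u else 0)
        = indicator {0..a} u *\<^sub>R f u"
    proof (cases "0 \<le> u")
      case True
      with powr_inverse_mult_le_iff[OF True t b \<theta>] b show ?thesis
        by (simp add: a_def indicator_def)
    qed simp
  qed simp
  also have "\<dots> = integral {0..a} f"
  proof (rule set_borel_integral_eq_integral)
    show "set_integrable lborel {0..a} f"
      unfolding f_def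
      by (intro borel_integrable_atLeastAtMost' continuous_on_diff continuous_on_mult
          continuous_on_const cont_powr) (use \<theta> in simp)
  qed
  also have "integral {0..a} f = f0 a - f0 0"
  proof (rule integral_unique, rule fundamental_theorem_of_calculus_interior)
    show "continuous_on {0..a} f0"
      unfolding f0_def
      by (intro continuous_on_diff continuous_on_mult continuous_on_const continuous_on_id cont_powr)
        (use \<theta> in \<open>simp add: add_pos_pos\<close>)
    fix u assume u: "u \<in> {0<..<a}"
    have "(f0 has_real_derivative \<theta> * b * ((1 + 1 / \<theta>) * u powr (1 + 1 / \<theta> - 1)) - \<theta> * t) (at u)"
      unfolding f0_def using u has_real_derivative_powr[of u "1 + 1 / \<theta>"]
      by (auto intro!: derivative_eq_intros)
    moreover have "\<theta> * b * ((1 + 1 / \<theta>) * u powr (1 + 1 / \<theta> - 1)) - \<theta> * t = f u"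
      using \<theta> by (simp add: f_def field_simps)
    ultimately show "(f0 has_vector_derivative f u) (at u)"
      by (simp add: has_real_derivative_iff_has_vector_derivative)
  qed (use a in auto)
  also have "f0 a - f0 0 = - \<theta> * max 0 (t - b)"
  proof (cases "b \<le> t")
    case True
    then have "1 \<le> (t / b) powr \<theta>" using b \<theta> by (intro ge_one_powr_ge_zero) auto
    then show ?thesis using True by (simp add: a_def f0_def algebra_simps)
  next
    case False
    then have tb: "t / b \<le> 1" using b by simp
    have "(t / b) powr \<theta> \<le> 1"
      using powr_mono2[of \<theta> "t / b" 1] tb t b \<theta> by simp
    then have aeq: "a = (t / b) powr \<theta>" by (simp add: a_def)
    have "a powr (1 + 1 / \<theta>) = (t / b) powr \<theta> * (t / b)"
    proof (cases "t = 0")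
      case False
      then have "a powr (1 + 1 / \<theta>) = (t / b) powr (\<theta> + 1)"
        unfolding aeq using \<theta> by (simp add: powr_powr distrib_left)
      also have "\<dots> = (t / b) powr \<theta> * (t / b)" using False t b by (simp add: powr_add)
      finally show ?thesis .
    qed (simp add: aeq)
    then show ?thesis using False b by (simp add: f0_def aeq)
  qed
  finally show ?thesis unfolding f_def .
qed

lemma cdf_equation:
  assumes t: "0 \<le> t"
  shows "t * cdf \<nu> t = integral {0..t} (cdf \<nu>)
    + \<theta> * (integral {0..t} (cdf \<nu>) - integral {0..t - 1} (cdf \<nu>))"
proof -
  \<comment> \<open>For \<open>x \<ge> 0\<close> this is
    \<open>x * indicator {..t} x - \<theta> * max 0 (t - x)\<close>, a combination which the average
    over the uniform variable turns into a multiple of \<open>max 0 (t - 1 - d)\<close>. It is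
    bounded, so the fixed-point equation applies before the mean is known to be finite.\<close>
  define g where "g x = (if 0 \<le> x \<and> x \<le> t then (1 + \<theta>) * x - \<theta> * t else 0)" for x :: real
  have "(\<integral>x. g x \<partial>\<nu>) = (\<integral>d. (LINT u:{0..1}|lborel. g (u powr (1 / \<theta>) * (d + 1))) \<partial>\<nu>)"
  proof (rule integral_fixpoint)
    show "g \<in> borel_measurable borel" unfolding g_def by measurable
    fix x
    show "\<bar>g x\<bar> \<le> (1 + \<theta>) * t + \<theta> * t"
    proof (cases "0 \<le> x \<and> x \<le> t")
      case True
      then have "(1 + \<theta>) * x \<le> (1 + \<theta>) * t" "0 \<le> (1 + \<theta>) * x" "0 \<le> \<theta> * t"
        using \<theta> t by (auto intro!: mult_left_mono)
      then show ?thesis unfolding g_def using True by auto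
    qed (use t \<theta> in \<open>auto simp: g_def\<close>)
  qed
  also have "\<dots> = (\<integral>d. - \<theta> * max 0 (t - 1 - d) \<partial>\<nu>)"
  proof (rule integral_cong_AE)
    show "AE d in \<nu>. (LINT u:{0..1}|lborel. g (u powr (1 / \<theta>) * (d + 1))) = - \<theta> * max 0 (t - 1 - d)"
      using AE_nonneg
    proof eventually_elim
      case (elim d)
      have "t - 1 - d = t - (d + 1)" by simp
      note * = this
      show ?case unfolding g_def * using integral_scaled_unit[OF t, of "d + 1"] elim by simp
    qed
  qed (unfold set_lebesgue_integral_def g_def, measurable)
  also have "\<dots> = - \<theta> * integral {0..t - 1} (cdf \<nu>)" by (simp add: integral_cdf)
  finally have "(\<integral>x. g x \<partial>\<nu>) = \<dots>" .
  moreover have "(\<integral>x. g x \<partial>\<nu>) = (\<integral>x. x * indicator {..t} x - \<theta> * max 0 (t - x) \<partial>\<nu>)"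
  proof (rule integral_cong_AE)
    show "AE x in \<nu>. g x = x * indicator {..t} x - \<theta> * max 0 (t - x)"
      using AE_nonneg
      by eventually_elim (auto simp: g_def algebra_simps split: split_indicator)
  qed (unfold g_def, measurable)
  moreover have "\<dots> = (\<integral>x. x * indicator {..t} x \<partial>\<nu>) - \<theta> * integral {0..t} (cdf \<nu>)"
    by (subst Bochner_Integration.integral_diff)
       (auto intro: integrable_below integrable_truncated simp: integral_cdf)
  ultimately show ?thesis by (simp add: integral_below algebra_simps)
qed

text \<open>The equation bounds its own truncated mean: the integral of \<open>x\<close> over
  \<open>{..t}\<close> is \<theta> times an increment of the integrated distribution function over a
  unit step, hence at most \<theta>. Fatou removes the truncation.\<close>

lemma integrable_id: "integrable \<nu> (\<lambda>x. x)"
proof (rule integrableI_bounded)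
  have mono_I: "integral {0..s} (cdf \<nu>) \<le> integral {0..t} (cdf \<nu>)" if "s \<le> t" for s t
    unfolding integral_cdf by (intro integral_mono integrable_truncated) (use that in auto)
  have inc: "integral {0..t} (cdf \<nu>) - integral {0..t - 1} (cdf \<nu>) \<le> 1" for t
  proof -
    have "integral {0..t} (cdf \<nu>) - integral {0..t - 1} (cdf \<nu>)
        = (\<integral>x. max 0 (t - x) - max 0 (t - 1 - x) \<partial>\<nu>)"
      by (simp add: integral_cdf integrable_truncated)
    also have "\<dots> \<le> (\<integral>x. 1 \<partial>\<nu>)"
      by (intro integral_mono Bochner_Integration.integrable_diff integrable_truncated) auto
    finally show ?thesis using prob_space by simp
  qed
  have "(\<integral>\<^sup>+x. ennreal (x * indicator {..real n} x) \<partial>\<nu>) \<le> ennreal \<theta>" for n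
  proof -
    have "(\<integral>\<^sup>+x. ennreal (x * indicator {..real n} x) \<partial>\<nu>)
        = ennreal (\<integral>x. x * indicator {..real n} x \<partial>\<nu>)"
      using AE_nonneg by (intro nn_integral_eq_integral integrable_below) (auto elim!: eventually_mono)
    also have "(\<integral>x. x * indicator {..real n} x \<partial>\<nu>) \<le> \<theta> * 1"
      using cdf_equation[of "real n"] mult_left_mono[OF inc[of "real n"], of \<theta>] \<theta>
      by (simp add: integral_below)
    finally show ?thesis by (simp add: ennreal_leI)
  qed
  note bound = this
  have "(\<integral>\<^sup>+x. ennreal (norm x) \<partial>\<nu>) = (\<integral>\<^sup>+x. ennreal x \<partial>\<nu>)"
    using AE_nonneg by (intro nn_integral_cong_AE) (auto elim!: eventually_mono)
  also have "\<dots> \<le> (\<integral>\<^sup>+x. liminf (\<lambda>n. ennreal (x * indicator {..real n} x)) \<partial>\<nu>)"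
  proof (intro nn_integral_mono)
    fix x
    obtain m :: nat where m: "x \<le> real m" using real_arch_simple by blast
    have "\<forall>\<^sub>F n in sequentially. x * indicator {..real n} x = x"
      using eventually_ge_at_top[of m] by eventually_elim (use m in \<open>auto split: split_indicator\<close>)
    then have "\<forall>\<^sub>F n in sequentially. ennreal x \<le> ennreal (x * indicator {..real n} x)"
      by eventually_elim (simp only: order_refl)
    then show "ennreal x \<le> liminf (\<lambda>n. ennreal (x * indicator {..real n} x))"
      by (rule Liminf_bounded)
  qed
  also have "\<dots> \<le> liminf (\<lambda>n. \<integral>\<^sup>+x. ennreal (x * indicator {..real n} x) \<partial>\<nu>)"
    by (rule nn_integral_liminf) measurable
  also have "\<dots> \<le> ennreal \<theta>"
    by (rule Liminf_le) (use bound in auto)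
  finally show "(\<integral>\<^sup>+x. ennreal (norm x) \<partial>\<nu>) < \<infinity>" by (simp add: le_less_trans)
qed simp

sublocale cdf: halfline_cdf "cdf \<nu>"
  by (rule halfline_cdf_cdf[OF integrable_id])

lemma cdf_I_equation: "0 \<le> t \<Longrightarrow> t * cdf \<nu> t = cdf.I t + \<theta> * (cdf.I t - cdf.I (t - 1))"
  using cdf_equation by (simp add: cdf.I_def)

text \<open>The density bound concerns \<open>x \<ge> 1\<close>, whereas
  \<open>\<theta> * cdf \<nu> 1\<close> is the slope on the left of 1. Differencing the equation
  between 1 and \<open>1 + h\<close> carries this slope across 1, up to errors of order
  \<open>h\<close> and \<open>cdf \<nu> h\<close>, which vanish with \<open>h\<close>.\<close>

lemma slope_bound:
  assumes inc: "\<And>x. 1 \<le> x \<Longrightarrow> cdf \<nu> x - cdf \<nu> 1 \<le> k * (x - 1)"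
  shows "\<theta> * cdf \<nu> 1 \<le> k"
proof -
  define c where "c = cdf \<nu> 1"
  have bound: "\<theta> * c \<le> k * (1 + h) + \<theta> * (c * h powr \<theta>)" if h: "0 < h" "h \<le> 1" for h
  proof -
    have "(1 + \<theta>) * (h * c) - \<theta> * (h * cdf \<nu> h) \<le> (1 + \<theta>) * (cdf.I (1 + h) - cdf.I 1) - \<theta> * (cdf.I h - cdf.I 0)"
      using cdf.I_diff_bounds(1)[of 1 "1 + h"] cdf.I_diff_bounds(2)[of 0 h] h \<theta>
      by (intro diff_mono mult_left_mono) (auto simp: c_def)
    also have "\<dots> = (1 + h) * cdf \<nu> (1 + h) - c"
      using cdf_I_equation[of "1 + h"] cdf_I_equation[of 1] h
      by (simp add: cdf.I_neg c_def algebra_simps)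
    also have "\<dots> \<le> (1 + h) * (c + k * h) - c"
      using inc[of "1 + h"] h by (intro diff_mono mult_left_mono) (auto simp: c_def)
    finally have "h * (\<theta> * c) \<le> h * (k * (1 + h) + \<theta> * cdf \<nu> h)" by (simp add: algebra_simps)
    then show ?thesis using h cdf_powr[of h] by (simp add: c_def)
  qed
  have "((\<lambda>h. k * (1 + h) + \<theta> * (c * h powr \<theta>)) \<longlongrightarrow> k * (1 + 0) + \<theta> * (c * 0)) (at_right 0)"
  proof (intro tendsto_intros)
    show "((\<lambda>h. h powr \<theta>) \<longlongrightarrow> 0) (at_right 0)"
      using tendsto_powr'[OF tendsto_ident_at[of "0::real" "{0<..}"] tendsto_const[of \<theta>]] \<theta>
      by (simp add: eventually_mono[OF eventually_at_right_less])
  qed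
  then have "\<theta> * c \<le> k * (1 + 0) + \<theta> * (c * 0)"
  proof (rule tendsto_lowerbound)
    show "\<forall>\<^sub>F h in at_right 0. \<theta> * c \<le> k * (1 + h) + \<theta> * (c * h powr \<theta>)"
      using eventually_at_right_less[of 0] eventually_at_right_field[of "\<lambda>h. h \<le> 1" 0]
      by (auto intro!: bound simp: eventually_at_right_field intro!: exI[of _ 1])
  qed simp
  then show ?thesis by (simp add: c_def)
qed

end

section \<open>Weighted sums with fixed weights\<close>

lemma tv_dist_upper: "\<bar>measure_pmf.prob p A - measure_pmf.prob q A\<bar> \<le> tv_dist p q"
proof -
  have "\<bar>measure_pmf.prob p B - measure_pmf.prob q B\<bar> \<le> 1" for B
    using measure_pmf.prob_le_1[of p B] measure_pmf.prob_le_1[of q B]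
      measure_nonneg[of p B] measure_nonneg[of q B] by linarith
  then show ?thesis
    unfolding tv_dist_def by (intro cSUP_upper bdd_aboveI2[where M=1]) simp_all
qed

lemma tv_dist_nonneg: "0 \<le> tv_dist p q"
  using tv_dist_upper[of p "{}" q] by simp

lemma pmf_x_min_pos: "0 < pmf p (x_min p)"
proof -
  obtain x where "x \<in> set_pmf p" using set_pmf_not_empty[of p] by blast
  then have "0 < pmf p x" by (rule pmf_positive)
  then show ?thesis unfolding x_min_def by (rule LeastI[where P="\<lambda>x. 0 < pmf p x"])
qed

lemma x_min_le: "x \<in> set_pmf p \<Longrightarrow> x_min p \<le> x"
  unfolding x_min_def by (rule Least_le[where P="\<lambda>x. 0 < pmf p x"]) (rule pmf_positive)

definition size_bias_defect :: "nat pmf \<Rightarrow> nat pmf \<Rightarrow> real" where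
  "size_bias_defect p q = tv_dist q (map_pmf Suc p) / pmf p (x_min p)"

lemma size_bias_defect_nonneg: "0 \<le> size_bias_defect p q"
  by (simp add: size_bias_defect_def tv_dist_nonneg pmf_x_min_pos)

text \<open>
  If \<open>x_min p\<close> lies outside the down-set \<open>A\<close>, both expectations vanish; otherwise \<open>A\<close> has
  probability at least \<open>pmf p (x_min p)\<close>. This is where the denominator in the error term comes from.
\<close>

lemma size_biased_down_set:
  fixes p q :: "nat pmf"
  defines "m \<equiv> measure_pmf.expectation p real"
  assumes fin: "integrable (measure_pmf p) real"
    and sb: "0 < m \<Longrightarrow> size_biased p q"
    and down: "\<And>x y. x \<in> A \<Longrightarrow> y \<le> x \<Longrightarrow> y \<in> A"
  shows "\<bar>measure_pmf.expectation p (\<lambda>x. real x * indicator A x) - m * measure_pmf.prob p {x. Suc x \<in> A}\<bar>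
    \<le> m * size_bias_defect p q * measure_pmf.prob p A"
proof -
  have m0: "0 \<le> m" unfolding m_def by simp
  have int: "integrable (measure_pmf p) (\<lambda>x. real x * indicator A x)"
    by (rule Bochner_Integration.integrable_bound[OF fin]) (auto split: split_indicator)
  show ?thesis
  proof (cases "m = 0")
    case True
    have "measure_pmf.expectation p (\<lambda>x. real x * indicator A x) \<le> m"
      unfolding m_def by (rule integral_mono[OF int fin]) (auto split: split_indicator)
    moreover have "0 \<le> measure_pmf.expectation p (\<lambda>x. real x * indicator A x)" by simp
    ultimately show ?thesis using True by simp
  next
    case False
    with m0 have m: "0 < m" by simp
    have "integrable (measure_pmf q) (indicator A :: nat \<Rightarrow> real)"
      by (rule measure_pmf.integrable_const_bound[where B=1]) (auto split: split_indicator)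
    then have E: "measure_pmf.expectation p (\<lambda>x. real x * indicator A x) = m * measure_pmf.prob q A"
      using sb[OF m] int unfolding size_biased_def m_def by simp
    show ?thesis
    proof (cases "x_min p \<in> A")
      case True
      have "pmf p (x_min p) \<le> measure_pmf.prob p A"
        using True by (subst pmf.rep_eq) (auto intro!: measure_pmf.finite_measure_mono)
      then have "1 \<le> measure_pmf.prob p A / pmf p (x_min p)" by (simp add: pmf_x_min_pos)
      have "{x. Suc x \<in> A} = Suc -` A" by auto
      then have "\<bar>measure_pmf.prob q A - measure_pmf.prob p {x. Suc x \<in> A}\<bar> \<le> tv_dist q (map_pmf Suc p)"
        using tv_dist_upper[of q A "map_pmf Suc p"] by simp
      also have "\<dots> \<le> tv_dist q (map_pmf Suc p) * (measure_pmf.prob p A / pmf p (x_min p))"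
        using mult_left_mono[OF \<open>1 \<le> _\<close> tv_dist_nonneg] by simp
      finally have "m * \<bar>measure_pmf.prob q A - measure_pmf.prob p {x. Suc x \<in> A}\<bar>
          \<le> m * (size_bias_defect p q * measure_pmf.prob p A)"
        using m by (intro mult_left_mono) (auto simp: size_bias_defect_def)
      moreover have "\<bar>m * measure_pmf.prob q A - m * measure_pmf.prob p {x. Suc x \<in> A}\<bar>
          = m * \<bar>measure_pmf.prob q A - measure_pmf.prob p {x. Suc x \<in> A}\<bar>"
        using m by (simp add: abs_mult flip: right_diff_distrib)
      ultimately show ?thesis by (simp add: E)
    next
      case False
      then have out: "x \<notin> A" if "x \<in> set_pmf p" for x
        using down[of x "x_min p"] x_min_le[OF that] by blast
      then have "measure_pmf.expectation p (\<lambda>x. real x * indicator A x) = measure_pmf.expectation p (\<lambda>_. 0)"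
        by (intro integral_cong_AE) (auto simp: AE_measure_pmf_iff)
      moreover have "measure_pmf.prob p {x. Suc x \<in> A} = 0"
      proof -
        have "x \<notin> set_pmf p" if "Suc x \<in> A" for x using out[of x] down[OF that, of x] by auto
        then show ?thesis by (auto simp: measure_pmf_zero_iff)
      qed
      ultimately show ?thesis using m by (simp add: size_bias_defect_nonneg)
    qed
  qed
qed

section \<open>Size-biasing one coordinate of a product law\<close>

lemma nn_integral_Pi_pmf_insert:
  assumes "finite J" "k \<notin> J"
  shows "(\<integral>\<^sup>+x. f x \<partial>Pi_pmf (insert k J) d p) = (\<integral>\<^sup>+x. (\<integral>\<^sup>+y. f (x(k := y)) \<partial>p k) \<partial>Pi_pmf J d p)"
  unfolding Pi_pmf_insert[OF assms]
  by (subst pair_commute_pmf) (simp add: nn_integral_pair_pmf' case_prod_unfold)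

lemma integrable_Pi_pmf_component:
  fixes f :: "'b \<Rightarrow> real"
  assumes "finite I" "k \<in> I" "integrable (measure_pmf (p k)) f"
  shows "integrable (measure_pmf (Pi_pmf I d p)) (\<lambda>x. f (x k))"
proof -
  have "integrable (measure_pmf (map_pmf (\<lambda>x. x k) (Pi_pmf I d p))) f"
    using assms by (simp add: Pi_pmf_component)
  then show ?thesis by (simp add: integrable_map_pmf_eq)
qed

text \<open>With the other coordinates frozen, \<open>{x. S x \<le> t}\<close> is a down-set in the
  \<open>k\<close>-th one because \<open>w k \<ge> 0\<close>, and a unit step there shifts
  \<open>S\<close> by \<open>w k\<close>. The one-dimensional estimate has an error proportional to
  the probability of the down-set, so averaging over the other coordinates yields a multiple of the
  probability of \<open>{x. S x \<le> t}\<close>.\<close>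

lemma size_biased_weighted_sum:
  fixes w :: "'i \<Rightarrow> real" and p :: "'i \<Rightarrow> nat pmf"
  assumes I: "finite I" "k \<in> I" and w: "0 \<le> w k"
    and fin: "integrable (measure_pmf (p k)) real"
    and sb: "0 < measure_pmf.expectation (p k) real \<Longrightarrow> size_biased (p k) q"
  defines "P \<equiv> Pi_pmf I 0 p" and "S \<equiv> \<lambda>x. \<Sum>j\<in>I. w j * real (x j)"
    and "m \<equiv> measure_pmf.expectation (p k) real"
  shows "\<bar>measure_pmf.expectation P (\<lambda>x. real (x k) * indicator {x. S x \<le> t} x)
      - m * measure_pmf.prob P {x. S x + w k \<le> t}\<bar>
    \<le> m * size_bias_defect (p k) q * measure_pmf.prob P {x. S x \<le> t}"
proof -
  define J where "J = I - {k}"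
  have J: "finite J" "k \<notin> J" "I = insert k J" using I by (auto simp: J_def)
  define m\<tau> where "m\<tau> = m * size_bias_defect (p k) q"
  have m0: "0 \<le> m" unfolding m_def by simp
  then have m\<tau>0: "0 \<le> m\<tau>" by (simp add: m\<tau>_def size_bias_defect_nonneg)
  define A where "A x = {y. (\<Sum>j\<in>J. w j * real (x j)) + w k * real y \<le> t}" for x
  have S: "S (x(k := y)) = (\<Sum>j\<in>J. w j * real (x j)) + w k * real y" for x y
  proof -
    have "(\<Sum>j\<in>J. w j * real ((x(k := y)) j)) = (\<Sum>j\<in>J. w j * real (x j))"
      using J by (intro sum.cong) auto
    then show ?thesis using J by (simp add: S_def)
  qed
  have down: "y \<in> A x" if "z \<in> A x" "y \<le> z" for x y z
    using that mult_left_mono[of "real y" "real z" "w k"] w by (auto simp: A_def)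
  define a where "a = (\<integral>\<^sup>+x. ennreal (real (x k) * indicator {x. S x \<le> t} x) \<partial>P)"
  define b where "b = (\<integral>\<^sup>+x. indicator {x. S x + w k \<le> t} x \<partial>P)"
  define g where "g = (\<integral>\<^sup>+x. indicator {x. S x \<le> t} x \<partial>P)"
  define a' where "a' x = (\<integral>\<^sup>+y. ennreal (real y * indicator (A x) y) \<partial>p k)" for x
  define b' where "b' x = emeasure (p k) {y. Suc y \<in> A x}" for x
  define g' where "g' x = emeasure (p k) (A x)" for x
  have a: "a = (\<integral>\<^sup>+x. a' x \<partial>Pi_pmf J 0 p)"
    unfolding a_def P_def J(3) nn_integral_Pi_pmf_insert[OF J(1,2)] a'_def
    by (intro nn_integral_cong) (auto simp: S A_def split: split_indicator)
  have b: "b = (\<integral>\<^sup>+x. b' x \<partial>Pi_pmf J 0 p)"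
    unfolding b_def P_def J(3) nn_integral_Pi_pmf_insert[OF J(1,2)] b'_def
  proof (intro nn_integral_cong)
    fix x
    have "indicator {x. S x + w k \<le> t} (x(k := y)) = (indicator {y. Suc y \<in> A x} y :: ennreal)" for y
      by (simp add: S A_def indicator_def algebra_simps)
    then show "(\<integral>\<^sup>+y. indicator {x. S x + w k \<le> t} (x(k := y)) \<partial>p k) = emeasure (p k) {y. Suc y \<in> A x}"
      by simp
  qed
  have g: "g = (\<integral>\<^sup>+x. g' x \<partial>Pi_pmf J 0 p)"
    unfolding g_def P_def J(3) nn_integral_Pi_pmf_insert[OF J(1,2)] g'_def
  proof (intro nn_integral_cong)
    fix x
    have "indicator {x. S x \<le> t} (x(k := y)) = (indicator (A x) y :: ennreal)" for y
      by (simp add: S A_def indicator_def)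
    then show "(\<integral>\<^sup>+y. indicator {x. S x \<le> t} (x(k := y)) \<partial>p k) = emeasure (p k) (A x)"
      by simp
  qed
  \<comment> \<open>The absolute value is split into two inequalities without subtraction, a form
    that can be integrated with values in \<open>ennreal\<close>.\<close>
  have inner: "a' x \<le> ennreal m * b' x + ennreal m\<tau> * g' x" "ennreal m * b' x \<le> a' x + ennreal m\<tau> * g' x" for x
  proof -
    let ?a = "measure_pmf.expectation (p k) (\<lambda>y. real y * indicator (A x) y)"
    let ?b = "measure_pmf.prob (p k) {y. Suc y \<in> A x}" and ?g = "measure_pmf.prob (p k) (A x)"
    have "integrable (measure_pmf (p k)) (\<lambda>y. real y * indicator (A x) y)"
      by (rule Bochner_Integration.integrable_bound[OF fin]) (auto split: split_indicator)
    then have a': "a' x = ennreal ?a"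
      unfolding a'_def by (intro nn_integral_eq_integral) auto
    have "\<bar>?a - m * ?b\<bar> \<le> m\<tau> * ?g"
      unfolding m_def m\<tau>_def by (rule size_biased_down_set[OF fin sb down])
    then have "?a \<le> m * ?b + m\<tau> * ?g" "m * ?b \<le> ?a + m\<tau> * ?g" by auto
    then show "a' x \<le> ennreal m * b' x + ennreal m\<tau> * g' x" "ennreal m * b' x \<le> a' x + ennreal m\<tau> * g' x"
      using m0 m\<tau>0
      by (simp_all add: a' b'_def g'_def measure_pmf.emeasure_eq_measure ennreal_mult[symmetric] ennreal_plus[symmetric]
          del: ennreal_plus)
  qed
  have "a \<le> ennreal m * b + ennreal m\<tau> * g"
    unfolding a b g by (subst (1 2) nn_integral_cmult[symmetric], simp, simp, subst nn_integral_add[symmetric])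
      (auto intro!: nn_integral_mono inner)
  moreover have "ennreal m * b \<le> a + ennreal m\<tau> * g"
    unfolding a b g by (subst (1 2) nn_integral_cmult[symmetric], simp, simp, subst nn_integral_add[symmetric])
      (auto intro!: nn_integral_mono inner)
  moreover have "a = ennreal (measure_pmf.expectation P (\<lambda>x. real (x k) * indicator {x. S x \<le> t} x))"
  proof -
    have "integrable (measure_pmf P) (\<lambda>x. real (x k))"
      unfolding P_def by (rule integrable_Pi_pmf_component[where f=real and p=p, OF I fin])
    then have "integrable (measure_pmf P) (\<lambda>x. real (x k) * indicator {x. S x \<le> t} x)"
      by (rule Bochner_Integration.integrable_bound) (auto split: split_indicator)
    then show ?thesis unfolding a_def by (intro nn_integral_eq_integral) auto
  qed
  moreover have "b = ennreal (measure_pmf.prob P {x. S x + w k \<le> t})" "g = ennreal (measure_pmf.prob P {x. S x \<le> t})"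
    by (simp_all add: b_def g_def measure_pmf.emeasure_eq_measure)
  ultimately show ?thesis
    using m0 m\<tau>0 unfolding m\<tau>_def[symmetric]
    by (simp add: ennreal_mult[symmetric] ennreal_plus[symmetric] abs_le_iff del: ennreal_plus)
qed

section \<open>Order statistics and the equation for the weighted sum\<close>

lemma order_stat_0 [simp]: "order_stat n w 0 = 0"
  by (simp add: order_stat_def)

lemma order_stat_mono:
  assumes w: "\<And>k. 1 \<le> k \<Longrightarrow> k \<le> n \<Longrightarrow> 0 \<le> w k" and jk: "j \<le> k" "k \<le> n"
  shows "order_stat n w j \<le> order_stat n w k"
proof -
  define L where "L = sort (map w [1..<Suc n])"
  have L: "length L = n" "set L = w ` {1..<Suc n}" "sorted L"
    by (simp_all add: L_def del: upt_Suc)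
  have os: "order_stat n w i = L ! (i - 1)" if "0 < i" for i
    using that by (simp add: order_stat_def L_def)
  consider "j = k" | "j = 0" "0 < k" | "0 < j" "j < k" using jk by linarith
  then show ?thesis
  proof cases
    case 2
    then have "L ! (k - 1) \<in> set L" using jk L(1) by (intro nth_mem) auto
    then show ?thesis using w L(2) 2 by (auto simp: os order_stat_def[of n w 0])
  next
    case 3
    then show ?thesis using jk sorted_nth_mono[OF L(3), of "j - 1" "k - 1"] L(1)
      by (simp add: os)
  qed simp
qed

locale weighted_sum =
  fixes n :: nat and w l :: "nat \<Rightarrow> real" and p q :: "nat \<Rightarrow> nat pmf" and s :: "nat \<Rightarrow> nat" and \<theta> :: real
  assumes n: "1 \<le> n" and \<theta>: "0 < \<theta>"
    and w: "\<And>k. 1 \<le> k \<Longrightarrow> k \<le> n \<Longrightarrow> 0 \<le> w k"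
    and s: "s permutes {1..n}" "\<And>k. 1 \<le> k \<Longrightarrow> k \<le> n \<Longrightarrow> w (s k) = order_stat n w k"
    and fin: "\<And>k. 1 \<le> k \<Longrightarrow> k \<le> n \<Longrightarrow> integrable (measure_pmf (p k)) real"
    and l: "\<And>k. 1 \<le> k \<Longrightarrow> k \<le> n \<Longrightarrow> l k = measure_pmf.expectation (p k) real"
    and sb: "\<And>k. 1 \<le> k \<Longrightarrow> k \<le> n \<Longrightarrow> 0 < l k \<Longrightarrow> size_biased (p k) (q k)"
begin

abbreviation "os \<equiv> order_stat n w"
abbreviation "\<delta> \<equiv> delta_max_os n w"
abbreviation "Dmax \<equiv> D_max_os \<theta> n w l s"
abbreviation "\<epsilon> \<equiv> eps_os \<theta> n w l s p q"

definition P where "P = Pi_pmf {1..n} 0 p"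
definition S where "S x = (\<Sum>k=1..n. w k * real (x k))"
definition N where "N = distr (measure_pmf P) borel S"

lemma l_nonneg: "1 \<le> k \<Longrightarrow> k \<le> n \<Longrightarrow> 0 \<le> l k"
  by (simp add: l)

lemma os_mono: "j \<le> k \<Longrightarrow> k \<le> n \<Longrightarrow> os j \<le> os k"
  by (rule order_stat_mono[OF w])

lemma os_nonneg: "k \<le> n \<Longrightarrow> 0 \<le> os k"
  using os_mono[of 0 k] by simp

lemma delta_upper: "k < n \<Longrightarrow> os (Suc k) - os k \<le> \<delta>"
  unfolding delta_max_os_def by (rule Max_ge) (auto intro!: image_eqI[of _ _ "Suc k"])

lemma delta_nonneg: "0 \<le> \<delta>"
  using delta_upper[of 0] os_nonneg[of 1] n by simp

lemma Dmax_nonneg: "0 \<le> Dmax"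
proof -
  have "\<bar>D_os \<theta> n w l s 1\<bar> \<le> Dmax" unfolding D_max_os_def by (rule Max_ge) (use n in auto)
  then show ?thesis by linarith
qed

lemma Dmax_upper: "k \<le> n \<Longrightarrow> \<bar>D_os \<theta> n w l s k\<bar> \<le> Dmax"
proof (cases "k = 0")
  case True
  then show ?thesis using Dmax_nonneg by (simp add: D_os_def)
next
  case False
  assume "k \<le> n"
  with False show ?thesis unfolding D_max_os_def by (intro Max_ge) auto
qed

definition defect where "defect = (\<Sum>k=1..n. l k * w k * size_bias_defect (p k) (q k))"

lemma defect_nonneg: "0 \<le> defect"
  unfolding defect_def by (intro sum_nonneg mult_nonneg_nonneg l_nonneg w size_bias_defect_nonneg) auto

lemma eps_eq: "\<epsilon> = \<delta> + 2 / \<theta> * Dmax + 2 / \<theta> * defect + \<bar>os n - 1\<bar>"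
  by (simp add: eps_os_def defect_def size_bias_defect_def)

text \<open>If all gaps vanished, every order statistic would be 0 and
  \<open>\<bar>os n - 1\<bar>\<close> would be 1. Strict positivity is what
  \<open>perturbed_dickman\<close> demands of \<open>e\<close>.\<close>

lemma eps_pos: "0 < \<epsilon>"
proof -
  have "os k \<le> real k * \<delta>" if "k \<le> n" for k
    using that
  proof (induction k)
    case (Suc k)
    then show ?case using delta_upper[of k] by (simp add: algebra_simps)
  qed simp
  from this[of n] have "0 < \<delta> + \<bar>os n - 1\<bar>"
    using delta_nonneg by (cases "\<delta> = 0") auto
  then show ?thesis using \<theta> Dmax_nonneg defect_nonneg unfolding eps_eq
    by (smt (verit) divide_nonneg_pos mult_nonneg_nonneg)
qed

lemma theta_eps_ge: "defect + (Dmax + \<theta> * max \<delta> \<bar>os n - 1\<bar>) \<le> \<theta> * \<epsilon>"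
proof -
  have "\<theta> * \<epsilon> = \<theta> * (\<delta> + \<bar>os n - 1\<bar>) + 2 * Dmax + 2 * defect"
    using \<theta> by (simp add: eps_eq field_simps)
  moreover have "\<theta> * max \<delta> \<bar>os n - 1\<bar> \<le> \<theta> * (\<delta> + \<bar>os n - 1\<bar>)"
    using \<theta> delta_nonneg by (intro mult_left_mono) auto
  ultimately show ?thesis using Dmax_nonneg defect_nonneg by linarith
qed

text \<open>For \<open>v \<ge> 0\<close> the subtracted term is \<open>\<theta> * min v 1\<close>.
  The weights below \<open>v\<close> are the first \<open>m\<close> order statistics; their sum
  telescopes to \<open>\<theta> * os m\<close> up to \<open>D_os\<close>, and \<open>os m\<close>
  misses \<open>min v 1\<close> by at most one gap or by \<open>\<bar>os n - 1\<bar>\<close>. For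
  \<open>v < 0\<close> both sides vanish, which confines the error to
  \<open>{x. S x \<le> t}\<close> when \<open>v = t - S x\<close>.\<close>

lemma partial_sum_bound:
  "\<bar>(\<Sum>k=1..n. l k * w k * (if w k \<le> v then 1 else 0)) - \<theta> * (max 0 v - max 0 (v - 1))\<bar>
    \<le> (Dmax + \<theta> * max \<delta> \<bar>os n - 1\<bar>) * (if 0 \<le> v then 1 else 0)"
proof (cases "0 \<le> v")
  case False
  then have "(\<Sum>k=1..n. l k * w k * (if w k \<le> v then 1 else 0)) = 0"
    using w by (intro sum.neutral) fastforce
  with False show ?thesis by simp
next
  case True
  \<comment> \<open>The index 0 always qualifies since \<open>os 0 = 0 \<le> v\<close>, so
    \<open>m = 0\<close> stands for the case that no weight is below \<open>v\<close>.\<close>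
  define m where "m = (GREATEST j. j \<le> n \<and> os j \<le> v)"
  have m: "m \<le> n" "os m \<le> v"
    using GreatestI_nat[of "\<lambda>j. j \<le> n \<and> os j \<le> v" 0 n] True by (auto simp: m_def)
  have m_max: "j \<le> m" if "j \<le> n" "os j \<le> v" for j
    using Greatest_le_nat[of "\<lambda>j. j \<le> n \<and> os j \<le> v" j n] that by (auto simp: m_def)
  have "(\<Sum>k=1..n. l k * w k * (if w k \<le> v then 1 else 0))
      = (\<Sum>j=1..n. l (s j) * w (s j) * (if w (s j) \<le> v then 1 else 0))"
    using sum.permute[OF s(1), of "\<lambda>k. l k * w k * (if w k \<le> v then 1 else 0)"]
    by (simp add: o_def)
  also have "\<dots> = (\<Sum>j=1..n. if j \<in> {1..m} then l (s j) * os j else 0)"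
  proof (intro sum.cong refl)
    fix j assume j: "j \<in> {1..n}"
    then have "os j \<le> v \<longleftrightarrow> j \<le> m" using m_max[of j] os_mono[of j m] m by auto
    then show "l (s j) * w (s j) * (if w (s j) \<le> v then 1 else 0) = (if j \<in> {1..m} then l (s j) * os j else 0)"
      using j s(2)[of j] by auto
  qed
  also have "\<dots> = (\<Sum>j\<in>{1..n} \<inter> {1..m}. l (s j) * os j)"
    by (rule sum.inter_restrict[symmetric]) simp
  also have "{1..n} \<inter> {1..m} = {1..m}" using m by auto
  also have "(\<Sum>j=1..m. l (s j) * os j) = D_os \<theta> n w l s m + (\<Sum>j=1..m. Delta_os \<theta> n w j)"
    by (simp add: D_os_def sum_subtractf)
  also have "(\<Sum>j=1..m. Delta_os \<theta> n w j) = \<theta> * os m"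
    by (induction m) (auto simp: Delta_os_def algebra_simps)
  finally have sum: "(\<Sum>k=1..n. l k * w k * (if w k \<le> v then 1 else 0)) = D_os \<theta> n w l s m + \<theta> * os m" .
  have "\<bar>os m - (max 0 v - max 0 (v - 1))\<bar> \<le> max \<delta> \<bar>os n - 1\<bar>"
  proof (cases "m = n")
    case True
    then show ?thesis using m \<open>0 \<le> v\<close> by (auto simp: max_def)
  next
    case False
    then have "m < n" using m by simp
    then have "v < os (Suc m)" using m_max[of "Suc m"] by force
    moreover have "os m \<le> os n" using os_mono m by simp
    ultimately show ?thesis using delta_upper[OF \<open>m < n\<close>] m \<open>0 \<le> v\<close> by (auto simp: max_def)
  qed
  then have "\<theta> * \<bar>os m - (max 0 v - max 0 (v - 1))\<bar> \<le> \<theta> * max \<delta> \<bar>os n - 1\<bar>"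
    using \<theta> by (intro mult_left_mono) auto
  moreover have "\<bar>\<theta> * os m - \<theta> * (max 0 v - max 0 (v - 1))\<bar> = \<theta> * \<bar>os m - (max 0 v - max 0 (v - 1))\<bar>"
    using \<theta> by (simp add: abs_mult flip: right_diff_distrib)
  ultimately have "\<bar>\<theta> * os m - \<theta> * (max 0 v - max 0 (v - 1))\<bar> \<le> \<theta> * max \<delta> \<bar>os n - 1\<bar>"
    by (simp only:)
  from add_mono[OF Dmax_upper[OF m(1)] this]
  have "\<bar>D_os \<theta> n w l s m + (\<theta> * os m - \<theta> * (max 0 v - max 0 (v - 1)))\<bar> \<le> Dmax + \<theta> * max \<delta> \<bar>os n - 1\<bar>"
    by (rule order_trans[OF abs_triangle_ineq])
  then show ?thesis unfolding sum using True by (simp only: if_True mult_1_right add_diff_eq)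
qed

lemma S_nonneg: "0 \<le> S x"
  unfolding S_def by (intro sum_nonneg mult_nonneg_nonneg w) auto

lemma integrable_component: "1 \<le> k \<Longrightarrow> k \<le> n \<Longrightarrow> integrable (measure_pmf P) (\<lambda>x. real (x k))"
  unfolding P_def by (rule integrable_Pi_pmf_component[where f=real and p=p, OF _ _ fin]) auto

lemma integrable_S: "integrable (measure_pmf P) S"
  unfolding S_def by (intro Bochner_Integration.integrable_sum integrable_mult_right integrable_component) auto

sublocale N: nonneg_law N
proof -
  interpret real_distribution N
    unfolding N_def by (rule prob_space.real_distribution_distr[OF measure_pmf.prob_space_axioms]) simp
  show "nonneg_law N"
  proof
    show "AE x in N. 0 \<le> x"
      unfolding N_def by (subst AE_distr_iff) (auto simp: S_nonneg)
  qed
qed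

sublocale N: halfline_cdf "cdf N"
  by (rule N.halfline_cdf_cdf) (simp add: N_def integrable_distr_eq integrable_S)

lemma cdf_N: "cdf N t = measure_pmf.prob P {x. S x \<le> t}"
  unfolding cdf_def N_def by (subst measure_distr) (auto simp: vimage_def)

text \<open>Two replacements are made: each \<open>x k\<close> is traded for a unit shift by
  size-biasing, at the cost \<open>defect\<close>, and the remaining step function in
  \<open>v = t - S x\<close> is traded for \<open>\<theta> * min v 1\<close>, at the cost
  \<open>R\<close>. Both costs are multiples of \<open>cdf N t\<close>, which gives the relative
  error.\<close>

lemma near_dickman_equation:
  assumes t: "0 \<le> t"
  shows "\<bar>t * cdf N t - N.I t - \<theta> * (N.I t - N.I (t - 1))\<bar> \<le> \<theta> * \<epsilon> * cdf N t"
proof -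
  define a where "a k = measure_pmf.expectation P (\<lambda>x. real (x k) * indicator {x. S x \<le> t} x)" for k
  define b where "b k = measure_pmf.prob P {x. S x + w k \<le> t}" for k
  define g where "g = cdf N t"
  define R where "R x = (\<Sum>k=1..n. l k * w k * (if w k \<le> t - S x then 1 else 0))
    - \<theta> * (max 0 (t - S x) - max 0 (t - S x - 1))" for x
  have int_a: "integrable (measure_pmf P) (\<lambda>x. real (x k) * indicator {x. S x \<le> t} x)" if "k \<in> {1..n}" for k
    by (rule Bochner_Integration.integrable_bound[OF integrable_component[of k]])
       (use that in \<open>auto split: split_indicator\<close>)
  have int_max: "integrable (measure_pmf P) (\<lambda>x. max 0 (u - S x))" for u
    using N.integrable_truncated[of u] by (simp add: N_def integrable_distr_eq)
  have I: "N.I u = measure_pmf.expectation P (\<lambda>x. max 0 (u - S x))" for u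
  proof -
    have "N.I u = (\<integral>x. max 0 (u - x) \<partial>N)" by (simp add: N.I_def N.integral_cdf)
    then show ?thesis by (simp add: N_def integral_distr)
  qed
  have int_b: "integrable (measure_pmf P) (\<lambda>x. c * (if w k \<le> t - S x then 1 else 0))" for c :: real and k
    by (intro integrable_mult_right measure_pmf.integrable_const_bound[where B=1]) auto
  have b: "measure_pmf.expectation P (\<lambda>x. c * (if w k \<le> t - S x then 1 else 0)) = c * b k" for c :: real and k
  proof -
    have "measure_pmf.expectation P (\<lambda>x. c * (if w k \<le> t - S x then 1 else 0))
        = measure_pmf.expectation P (\<lambda>x. c * indicator {x. S x + w k \<le> t} x)"
      by (intro Bochner_Integration.integral_cong) (auto simp: algebra_simps split: split_indicator)
    then show ?thesis by (simp add: b_def)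
  qed
  have "t * cdf N t - N.I t = (\<integral>x. x * indicator {..t} x \<partial>N)"
    by (simp add: N.integral_below N.I_def)
  also have "\<dots> = measure_pmf.expectation P (\<lambda>x. S x * indicator {..t} (S x))"
    by (simp add: N_def integral_distr)
  also have "\<dots> = measure_pmf.expectation P (\<lambda>x. \<Sum>k=1..n. w k * (real (x k) * indicator {x. S x \<le> t} x))"
  proof (intro Bochner_Integration.integral_cong refl)
    show "S x * indicator {..t} (S x) = (\<Sum>k=1..n. w k * (real (x k) * indicator {x. S x \<le> t} x))" for x
      unfolding S_def[of x, symmetric]
      by (cases "S x \<le> t") (simp_all add: S_def)
  qed
  also have "\<dots> = (\<Sum>k=1..n. w k * a k)"
    unfolding a_def by (subst Bochner_Integration.integral_sum) (auto intro!: integrable_mult_right int_a)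
  finally have 1: "t * cdf N t - N.I t = (\<Sum>k=1..n. w k * a k)" .
  have int_R: "integrable (measure_pmf P) R"
    unfolding R_def Groups.diff_right_commute[of t _ 1]
    by (intro Bochner_Integration.integrable_diff Bochner_Integration.integrable_sum int_b
        integrable_mult_right int_max)
  have int_sum: "measure_pmf.expectation P (\<lambda>x. \<Sum>k=1..n. l k * w k * (if w k \<le> t - S x then 1 else 0))
      = (\<Sum>k=1..n. l k * w k * b k)"
    by (subst Bochner_Integration.integral_sum) (simp_all only: int_b b)
  have "measure_pmf.expectation P R
      = (\<Sum>k=1..n. l k * w k * b k) - \<theta> * (N.I t - N.I (t - 1))"
    unfolding R_def I Groups.diff_right_commute[of t _ 1]
    by (subst Bochner_Integration.integral_diff)
       (auto simp: int_sum[simplified] int_max intro!: Bochner_Integration.integrable_sum int_b integrable_mult_right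
         Bochner_Integration.integrable_diff)
  then have 2: "t * cdf N t - N.I t - \<theta> * (N.I t - N.I (t - 1))
      = (\<Sum>k=1..n. w k * (a k - l k * b k)) + measure_pmf.expectation P R"
    using 1 by (simp add: right_diff_distrib sum_subtractf mult_ac)
  have "\<bar>\<Sum>k=1..n. w k * (a k - l k * b k)\<bar> \<le> (\<Sum>k=1..n. l k * w k * size_bias_defect (p k) (q k) * g)"
  proof (rule order_trans[OF sum_abs sum_mono])
    fix k assume "k \<in> {1..n}"
    then have k: "1 \<le> k" "k \<le> n" by auto
    have "\<bar>a k - l k * b k\<bar> \<le> l k * size_bias_defect (p k) (q k) * g"
      using size_biased_weighted_sum[of "{1..n}" k w p "q k" t] k w[OF k] fin[OF k] sb[OF k]
      unfolding a_def b_def g_def cdf_N P_def S_def l[OF k] by simp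
    then have "w k * \<bar>a k - l k * b k\<bar> \<le> w k * (l k * size_bias_defect (p k) (q k) * g)"
      using w[OF k] by (rule mult_left_mono)
    then show "\<bar>w k * (a k - l k * b k)\<bar> \<le> l k * w k * size_bias_defect (p k) (q k) * g"
      using w[OF k] by (simp add: abs_mult mult_ac)
  qed
  also have "\<dots> = defect * g" by (simp add: defect_def sum_distrib_right)
  finally have 3: "\<bar>\<Sum>k=1..n. w k * (a k - l k * b k)\<bar> \<le> defect * g" .
  let ?C = "Dmax + \<theta> * max \<delta> \<bar>os n - 1\<bar>"
  have "\<bar>measure_pmf.expectation P R\<bar> \<le> measure_pmf.expectation P (\<lambda>x. \<bar>R x\<bar>)"
    by (rule integral_abs_bound)
  also have "\<dots> \<le> measure_pmf.expectation P (\<lambda>x. ?C * indicator {x. S x \<le> t} x)"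
  proof (rule integral_mono)
    show "\<bar>R x\<bar> \<le> ?C * indicator {x. S x \<le> t} x" for x
      using partial_sum_bound[of "t - S x"] by (simp add: R_def indicator_def split: if_splits)
    show "integrable (measure_pmf P) (\<lambda>x. ?C * indicator {x. S x \<le> t} x)"
      by (intro integrable_mult_right measure_pmf.integrable_const_bound[where B=1]) auto
  qed (use int_R in simp)
  also have "\<dots> = ?C * g" by (simp add: g_def cdf_N)
  finally have 4: "\<bar>measure_pmf.expectation P R\<bar> \<le> ?C * g" .
  have "(defect + ?C) * g \<le> \<theta> * \<epsilon> * g"
    using theta_eps_ge by (rule mult_right_mono) (simp add: g_def N.nonneg)
  then have "defect * g + ?C * g \<le> \<theta> * \<epsilon> * g" by (simp only: distrib_right)
  with add_mono[OF 3 4] show ?thesis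
    unfolding 2 unfolding g_def by (meson abs_triangle_ineq order_trans)
qed

end

section \<open>Bounds for one realisation of the weights\<close>

locale dickman_approximation = weighted_sum n w l p q s \<theta> + D: dickman \<theta> \<nu>
  for n w l p q s \<theta> \<nu>
begin

sublocale perturbed_dickman "cdf \<nu>" "cdf N" \<theta> "\<theta> * \<epsilon>" "cdf \<nu> 1"
proof
  show "0 < \<theta> * \<epsilon>" using \<theta> eps_pos by simp
qed (fact \<theta> D.cdf_powr D.cdf_I_equation near_dickman_equation)+

lemma cdf_bound_less_1:
  assumes "\<theta> < 1" "0 \<le> t"
  shows "\<bar>measure_pmf.prob (Pi_pmf {1..n} 0 p) {x. (\<Sum>k=1..n. w k * real (x k)) \<le> t} - cdf \<nu> t\<bar>
    \<le> 2 * \<theta>\<^sup>2 * \<epsilon> + 3 * (6 * \<theta> * \<epsilon>) powr \<theta>"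
  using H_bound_theta_less_1[OF assms(1) D.cdf.nonneg assms(2)]
  by (simp add: H_def cdf_N P_def S_def power2_eq_square mult.assoc)

lemma cdf_bound_ge_1:
  assumes \<theta>1: "1 \<le> \<theta>" and k: "0 < k" and t: "0 \<le> t"
    and inc: "\<And>x. 1 \<le> x \<Longrightarrow> cdf \<nu> x - cdf \<nu> 1 \<le> k * (x - 1)"
  shows "\<bar>measure_pmf.prob (Pi_pmf {1..n} 0 p) {x. (\<Sum>k=1..n. w k * real (x k)) \<le> t} - cdf \<nu> t\<bar>
    \<le> (2 * \<theta>\<^sup>2 + 16 * \<theta> * k) * \<epsilon>"
proof -
  have ck: "\<theta> * cdf \<nu> 1 \<le> k" by (rule D.slope_bound[OF inc])
  have c0: "0 \<le> cdf \<nu> 1" by (rule D.cdf.nonneg)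
  have c: "cdf \<nu> 1 \<le> k" using ck mult_right_mono[OF \<theta>1 c0] by simp
  \<comment> \<open>This extends the slope bound to the whole half-line, as
    \<open>slope_bound_ge\<close> requires: up to 1 by the power law with
    \<open>\<theta> \<ge> 1\<close>, beyond 1 by the density bound.\<close>
  have "cdf \<nu> x \<le> k * x" if x: "0 \<le> x" for x
  proof (cases "x \<le> 1")
    case True
    have "cdf \<nu> x = cdf \<nu> 1 * x powr \<theta>" using D.cdf_powr[OF x True] .
    also have "\<dots> \<le> k * x"
    proof (rule mult_mono[OF c])
      show "x powr \<theta> \<le> x"
        using powr_mono'[of 1 \<theta> x] \<theta>1 x True by (cases "x = 0") auto
    qed (use k in auto)
    finally show ?thesis .
  next
    case False
    then show ?thesis using inc[of x] c by (simp add: algebra_simps)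
  qed
  then have "1 \<le> 2 * \<theta> * k"
    using D.cdf.slope_bound_ge[OF \<theta> k] D.cdf_I_equation by blast
  from H_bound_theta_ge_1[OF \<theta>1 c0 ck this t] show ?thesis
    by (simp add: H_def cdf_N P_def S_def power2_eq_square algebra_simps)
qed

end

section \<open>Conditioning on the weights\<close>

locale prob_subalgebra = prob_space M + finite_measure_subalgebra M F for M F :: "'a measure"
begin

lemma nn_integral_cond_prob:
  assumes A: "A \<in> sets F" and C: "C \<in> sets M"
  shows "(\<integral>\<^sup>+\<omega>. indicator A \<omega> * ennreal (cond_prob_sub M F C \<omega>) \<partial>M) = emeasure M (A \<inter> C)"
proof -
  have A_M: "A \<in> sets M" using A subalg by (auto simp: subalgebra_def)
  have int: "integrable M (\<lambda>\<omega>. indicator A \<omega> * indicator C \<omega> :: real)"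
    using A_M C by (intro integrable_const_bound[where B=1]) (auto split: split_indicator)
  have pos: "AE \<omega> in M. 0 \<le> cond_prob_sub M F C \<omega>"
    unfolding cond_prob_sub_def using C by (intro real_cond_exp_pos) auto
  have "(\<integral>\<^sup>+\<omega>. indicator A \<omega> * ennreal (cond_prob_sub M F C \<omega>) \<partial>M)
      = (\<integral>\<^sup>+\<omega>. ennreal (indicator A \<omega> * cond_prob_sub M F C \<omega>) \<partial>M)"
    by (intro nn_integral_cong) (auto split: split_indicator)
  also have "\<dots> = ennreal (\<integral>\<omega>. indicator A \<omega> * cond_prob_sub M F C \<omega> \<partial>M)"
  proof (rule nn_integral_eq_integral)
    show "integrable M (\<lambda>\<omega>. indicator A \<omega> * cond_prob_sub M F C \<omega>)"
      unfolding cond_prob_sub_def using int A C by (intro real_cond_exp_intg(1)) auto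
    show "AE \<omega> in M. 0 \<le> indicator A \<omega> * cond_prob_sub M F C \<omega>"
      using pos by eventually_elim (simp split: split_indicator)
  qed
  also have "(\<integral>\<omega>. indicator A \<omega> * cond_prob_sub M F C \<omega> \<partial>M) = (\<integral>\<omega>. indicator A \<omega> * indicator C \<omega> \<partial>M)"
    unfolding cond_prob_sub_def using int A C by (intro real_cond_exp_intg(2)) auto
  also have "\<dots> = measure M (A \<inter> C)"
    using A_M C by (simp add: indicator_inter_arith[symmetric])
  finally show ?thesis by (simp add: emeasure_eq_measure)
qed

text \<open>With \<open>g\<close> the inclusion of the naturals, this turns finiteness of the
  conditional mean into integrability under the conditional law.\<close>

lemma nn_cond_exp_cond_law:
  assumes law: "cond_law M F Y \<mu>" and [measurable]: "Y \<in> measurable M (count_space UNIV)"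
  shows "AE \<omega> in M. (\<integral>\<^sup>+x. g x \<partial>\<mu> \<omega>) = nn_cond_exp M F (\<lambda>\<omega>. g (Y \<omega>)) \<omega>"
proof -
  have \<mu>_F: "(\<lambda>\<omega>. pmf (\<mu> \<omega>) x) \<in> borel_measurable F" for x
    using law unfolding cond_law_def by (rule conjunct1[THEN spec])
  have \<mu>_M[measurable]: "(\<lambda>\<omega>. pmf (\<mu> \<omega>) x) \<in> borel_measurable M" for x
    by (rule measurable_from_subalg[OF subalg \<mu>_F])
  have C: "{\<omega> \<in> space M. Y \<omega> = x} \<in> sets M" for x by measurable
  have exp_eq: "(\<integral>\<^sup>+x. g x \<partial>\<mu> \<omega>) = (\<Sum>x. ennreal (pmf (\<mu> \<omega>) x) * g x)" for \<omega>
    unfolding nn_integral_measure_pmf nn_integral_count_space_nat ..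
  show ?thesis
  proof (rule nn_cond_exp_charact)
    fix A assume A: "A \<in> sets F"
    then have A_M[measurable]: "A \<in> sets M" using subalg by (auto simp: subalgebra_def)
    have "(\<integral>\<^sup>+\<omega>\<in>A. (\<integral>\<^sup>+x. g x \<partial>\<mu> \<omega>) \<partial>M) = (\<integral>\<^sup>+\<omega>. (\<Sum>x. g x * (indicator A \<omega> * ennreal (pmf (\<mu> \<omega>) x))) \<partial>M)"
      unfolding exp_eq ennreal_suminf_multc[symmetric] by (simp only: mult_ac)
    also have "\<dots> = (\<Sum>x. \<integral>\<^sup>+\<omega>. g x * (indicator A \<omega> * ennreal (pmf (\<mu> \<omega>) x)) \<partial>M)"
      by (rule nn_integral_suminf) measurable
    also have "\<dots> = (\<Sum>x. \<integral>\<^sup>+\<omega>. g x * indicator (A \<inter> {\<omega> \<in> space M. Y \<omega> = x}) \<omega> \<partial>M)"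
    proof (intro suminf_cong)
      fix x
      have "AE \<omega> in M. pmf (\<mu> \<omega>) x = cond_prob_sub M F {\<omega> \<in> space M. Y \<omega> = x} \<omega>"
        using law by (simp add: cond_law_def)
      then have "(\<integral>\<^sup>+\<omega>. indicator A \<omega> * ennreal (pmf (\<mu> \<omega>) x) \<partial>M)
          = (\<integral>\<^sup>+\<omega>. indicator A \<omega> * ennreal (cond_prob_sub M F {\<omega> \<in> space M. Y \<omega> = x} \<omega>) \<partial>M)"
        by (intro nn_integral_cong_AE) (auto elim!: eventually_mono)
      also have "\<dots> = emeasure M (A \<inter> {\<omega> \<in> space M. Y \<omega> = x})" by (rule nn_integral_cond_prob[OF A C])
      finally have E: "(\<integral>\<^sup>+\<omega>. indicator A \<omega> * ennreal (pmf (\<mu> \<omega>) x) \<partial>M)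
          = emeasure M (A \<inter> {\<omega> \<in> space M. Y \<omega> = x})" .
      have "(\<integral>\<^sup>+\<omega>. g x * (indicator A \<omega> * ennreal (pmf (\<mu> \<omega>) x)) \<partial>M)
          = g x * (\<integral>\<^sup>+\<omega>. indicator A \<omega> * ennreal (pmf (\<mu> \<omega>) x) \<partial>M)"
        by (rule nn_integral_cmult) measurable
      also have "\<dots> = (\<integral>\<^sup>+\<omega>. g x * indicator (A \<inter> {\<omega> \<in> space M. Y \<omega> = x}) \<omega> \<partial>M)"
        unfolding E by (rule nn_integral_cmult_indicator[symmetric]) (rule sets.Int[OF A_M C])
      finally show "(\<integral>\<^sup>+\<omega>. g x * (indicator A \<omega> * ennreal (pmf (\<mu> \<omega>) x)) \<partial>M)
          = (\<integral>\<^sup>+\<omega>. g x * indicator (A \<inter> {\<omega> \<in> space M. Y \<omega> = x}) \<omega> \<partial>M)" .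
    qed
    also have "\<dots> = (\<integral>\<^sup>+\<omega>. (\<Sum>x. g x * indicator (A \<inter> {\<omega> \<in> space M. Y \<omega> = x}) \<omega>) \<partial>M)"
    proof (rule nn_integral_suminf[symmetric])
      show "(\<lambda>\<omega>. g x * indicator (A \<inter> {\<omega> \<in> space M. Y \<omega> = x}) \<omega>) \<in> borel_measurable M" for x
        by (intro borel_measurable_times_ennreal borel_measurable_const borel_measurable_indicator sets.Int[OF A_M C])
    qed
    also have "\<dots> = (\<integral>\<^sup>+\<omega>\<in>A. g (Y \<omega>) \<partial>M)"
    proof (intro nn_integral_cong)
      fix \<omega> assume \<omega>: "\<omega> \<in> space M"
      have "(\<lambda>x. g x * indicator (A \<inter> {\<omega> \<in> space M. Y \<omega> = x}) \<omega>)
          = (\<lambda>x. if x = Y \<omega> then g (Y \<omega>) * indicator A \<omega> else 0)"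
        using \<omega> by (intro ext) (simp add: indicator_def)
      then show "(\<Sum>x. g x * indicator (A \<inter> {\<omega> \<in> space M. Y \<omega> = x}) \<omega>) = g (Y \<omega>) * indicator A \<omega>"
        by (simp only: sums_unique[OF sums_single, symmetric])
    qed
    finally show "(\<integral>\<^sup>+\<omega>\<in>A. g (Y \<omega>) \<partial>M) = (\<integral>\<^sup>+\<omega>\<in>A. (\<integral>\<^sup>+x. g x \<partial>\<mu> \<omega>) \<partial>M)" ..
  next
    show "(\<lambda>\<omega>. g (Y \<omega>)) \<in> borel_measurable M"
      by (rule measurable_compose[of Y M "count_space UNIV"]) simp_all
    show "(\<lambda>\<omega>. \<integral>\<^sup>+x. g x \<partial>\<mu> \<omega>) \<in> borel_measurable F"
      unfolding exp_eq
      by (intro borel_measurable_suminf_order borel_measurable_times_ennreal borel_measurable_const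
          measurable_compose[OF \<mu>_F measurable_ennreal])
  qed
qed

text \<open>The event \<open>E \<omega>\<close> may vary with \<omega>, but only through
  \<open>F\<close>, so it acts as a constant under conditioning; this is what allows the weights to
  be frozen. Integer values reduce everything to a countable sum over the possible vectors
  \<open>x\<close>.\<close>

lemma
  assumes I: "finite I" "I \<noteq> {}" "I \<subseteq> K"
    and indep: "cond_indep_nat M F X K"
    and law: "\<And>k. k \<in> I \<Longrightarrow> cond_law M F (X k) (\<mu> k)"
    and E: "\<And>x. {\<omega> \<in> space M. x \<in> E \<omega>} \<in> sets F"
  shows measurable_conditional_prob:
      "(\<lambda>\<omega>. measure_pmf.prob (Pi_pmf I 0 (\<lambda>k. \<mu> k \<omega>)) (E \<omega>)) \<in> borel_measurable M"
    and prob_eq_integral_conditional_prob: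
      "emeasure M {\<omega> \<in> space M. (\<lambda>k. if k \<in> I then X k \<omega> else 0) \<in> E \<omega>}
        = (\<integral>\<^sup>+\<omega>. ennreal (measure_pmf.prob (Pi_pmf I 0 (\<lambda>k. \<mu> k \<omega>)) (E \<omega>)) \<partial>M)"
proof -
  \<comment> \<open>The entry 0 outside \<open>I\<close> agrees with the default of
    \<open>Pi_pmf I 0\<close>. Hence \<open>D\<close> carries the product law, and it is
    countable.\<close>
  define D where "D = PiE_dflt I (0::nat) (\<lambda>_. UNIV)"
  define f where "f x \<omega> = indicator {\<omega> \<in> space M. x \<in> E \<omega>} \<omega> * ennreal (\<Prod>k\<in>I. pmf (\<mu> k \<omega>) (x k))" for x \<omega>
  define C where "C x = {\<omega> \<in> space M. \<forall>k\<in>I. X k \<omega> \<in> {x k}}" for x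
  have countable_D: "countable D"
    unfolding D_def dflt_image_PiE[symmetric] by (intro countable_image countable_PiE I) auto
  have X[measurable]: "X k \<in> measurable M (count_space UNIV)" if "k \<in> I" for k
    using indep that I by (auto simp: cond_indep_nat_def)
  have C: "C x \<in> sets M" for x
    unfolding C_def using I by (intro sets.sets_Collect_finite_All) (auto intro!: measurable_sets_Collect X)
  have E_M[measurable]: "{\<omega> \<in> space M. x \<in> E \<omega>} \<in> sets M" for x
    using E subalg by (auto simp: subalgebra_def)
  have \<mu>_M[measurable]: "(\<lambda>\<omega>. pmf (\<mu> k \<omega>) x) \<in> borel_measurable M" if "k \<in> I" for k x
    using law[OF that] by (intro measurable_from_subalg[OF subalg]) (simp add: cond_law_def)
  have f_M: "f x \<in> borel_measurable M" for x unfolding f_def by measurable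
  have prob_eq: "ennreal (measure_pmf.prob (Pi_pmf I 0 (\<lambda>k. \<mu> k \<omega>)) (E \<omega>)) = (\<integral>\<^sup>+x. f x \<omega> \<partial>count_space D)"
    if \<omega>: "\<omega> \<in> space M" for \<omega>
  proof -
    have "ennreal (measure_pmf.prob (Pi_pmf I 0 (\<lambda>k. \<mu> k \<omega>)) (E \<omega>))
        = (\<integral>\<^sup>+x. indicator (E \<omega>) x \<partial>Pi_pmf I 0 (\<lambda>k. \<mu> k \<omega>))"
      by (simp add: measure_pmf.emeasure_eq_measure)
    also have "\<dots> = (\<integral>\<^sup>+x. ennreal (pmf (Pi_pmf I 0 (\<lambda>k. \<mu> k \<omega>)) x) * indicator (E \<omega>) x \<partial>count_space UNIV)"
      by (rule nn_integral_measure_pmf)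
    also have "\<dots> = (\<integral>\<^sup>+x. f x \<omega> * indicator D x \<partial>count_space UNIV)"
      using I(1) \<omega> by (intro nn_integral_cong)
        (auto simp: f_def D_def PiE_dflt_def pmf_Pi split: split_indicator)
    also have "\<dots> = (\<integral>\<^sup>+x. f x \<omega> \<partial>count_space D)"
      by (simp add: nn_integral_count_space_indicator)
    finally show ?thesis .
  qed
  have "(\<lambda>(x, \<omega>). f x \<omega>) \<in> borel_measurable (count_space D \<Otimes>\<^sub>M M)"
    by (rule measurable_pair_measure_countable1[OF countable_D]) (simp add: f_M)
  from measurable_pair_swap[OF this]
  have "(\<lambda>(\<omega>, x). f x \<omega>) \<in> borel_measurable (M \<Otimes>\<^sub>M count_space D)"
    by (simp add: case_prod_unfold)
  then have "(\<lambda>\<omega>. \<integral>\<^sup>+x. f x \<omega> \<partial>count_space D) \<in> borel_measurable M"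
    by (rule sigma_finite_measure.borel_measurable_nn_integral[OF
        sigma_finite_measure_count_space_countable[OF countable_D]])
  then have "(\<lambda>\<omega>. ennreal (measure_pmf.prob (Pi_pmf I 0 (\<lambda>k. \<mu> k \<omega>)) (E \<omega>))) \<in> borel_measurable M"
    by (subst measurable_cong[OF prob_eq])
  then have "(\<lambda>\<omega>. enn2real (ennreal (measure_pmf.prob (Pi_pmf I 0 (\<lambda>k. \<mu> k \<omega>)) (E \<omega>)))) \<in> borel_measurable M"
    by measurable
  then show "(\<lambda>\<omega>. measure_pmf.prob (Pi_pmf I 0 (\<lambda>k. \<mu> k \<omega>)) (E \<omega>)) \<in> borel_measurable M"
    by simp
  \<comment> \<open>Conditional independence is applied to the singletons \<open>{x k}\<close> only;
    summation over \<open>D\<close> recovers general events.\<close>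
  have summand: "(\<integral>\<^sup>+\<omega>. f x \<omega> \<partial>M) = (\<integral>\<^sup>+\<omega>. indicator ({\<omega> \<in> space M. x \<in> E \<omega>} \<inter> C x) \<omega> \<partial>M)" for x
  proof -
    have "AE \<omega> in M. cond_prob_sub M F (C x) \<omega>
        = (\<Prod>k\<in>I. cond_prob_sub M F {\<omega> \<in> space M. X k \<omega> \<in> {x k}} \<omega>)"
      unfolding C_def
      by (rule indep[unfolded cond_indep_nat_def, THEN conjunct2, THEN spec[of _ I],
            THEN spec[of _ "\<lambda>k. {x k}"], rule_format]) (rule I)+
    moreover have "AE \<omega> in M. \<forall>k\<in>I. pmf (\<mu> k \<omega>) (x k) = cond_prob_sub M F {\<omega> \<in> space M. X k \<omega> = x k} \<omega>"
      using law I(1) by (intro AE_finite_allI) (auto simp: cond_law_def)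
    ultimately have "AE \<omega> in M. (\<Prod>k\<in>I. pmf (\<mu> k \<omega>) (x k)) = cond_prob_sub M F (C x) \<omega>"
      by eventually_elim simp
    then have "AE \<omega> in M. f x \<omega> = indicator {\<omega> \<in> space M. x \<in> E \<omega>} \<omega> * ennreal (cond_prob_sub M F (C x) \<omega>)"
      unfolding f_def by eventually_elim (simp only:)
    then have "(\<integral>\<^sup>+\<omega>. f x \<omega> \<partial>M) = (\<integral>\<^sup>+\<omega>. indicator {\<omega> \<in> space M. x \<in> E \<omega>} \<omega> * ennreal (cond_prob_sub M F (C x) \<omega>) \<partial>M)"
      by (rule nn_integral_cong_AE)
    then show ?thesis using nn_integral_cond_prob[OF E C] C[of x] by simp
  qed
  have single: "(\<integral>\<^sup>+x. indicator ({\<omega> \<in> space M. x \<in> E \<omega>} \<inter> C x) \<omega> \<partial>count_space D)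
      = indicator {\<omega> \<in> space M. (\<lambda>k. if k \<in> I then X k \<omega> else 0) \<in> E \<omega>} \<omega>" (is "?L = ?R")
    if \<omega>: "\<omega> \<in> space M" for \<omega>
  proof -
    define x0 where "x0 = (\<lambda>k. if k \<in> I then X k \<omega> else 0)"
    have x0: "x0 \<in> D" by (auto simp: x0_def D_def PiE_dflt_def)
    have "\<omega> \<in> C x \<longleftrightarrow> x = x0" if "x \<in> D" for x
      using that \<omega> by (auto simp: C_def x0_def D_def PiE_dflt_def fun_eq_iff)
    then have "?L = (\<integral>\<^sup>+x. ?R * indicator {x0} x \<partial>count_space D)"
      using \<omega> by (intro nn_integral_cong) (auto simp: x0_def[symmetric] split: split_indicator)
    also have "\<dots> = ?R" using x0 by (simp add: nn_integral_cmult_indicator)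
    finally show ?thesis .
  qed
  have "(\<integral>\<^sup>+\<omega>. ennreal (measure_pmf.prob (Pi_pmf I 0 (\<lambda>k. \<mu> k \<omega>)) (E \<omega>)) \<partial>M)
      = (\<integral>\<^sup>+\<omega>. (\<integral>\<^sup>+x. f x \<omega> \<partial>count_space D) \<partial>M)"
    by (intro nn_integral_cong prob_eq)
  also have "\<dots> = (\<integral>\<^sup>+x. (\<integral>\<^sup>+\<omega>. indicator ({\<omega> \<in> space M. x \<in> E \<omega>} \<inter> C x) \<omega> \<partial>M) \<partial>count_space D)"
    by (subst nn_integral_count_space_nn_integral[OF countable_D f_M]) (simp only: summand)
  also have "\<dots> = (\<integral>\<^sup>+\<omega>. (\<integral>\<^sup>+x. indicator ({\<omega> \<in> space M. x \<in> E \<omega>} \<inter> C x) \<omega> \<partial>count_space D) \<partial>M)"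
    using C by (intro nn_integral_count_space_nn_integral[OF countable_D, symmetric]) auto
  also have "\<dots> = (\<integral>\<^sup>+\<omega>. indicator {\<omega> \<in> space M. (\<lambda>k. if k \<in> I then X k \<omega> else 0) \<in> E \<omega>} \<omega> \<partial>M)"
    by (intro nn_integral_cong single)
  also have "\<dots> = emeasure M {\<omega> \<in> space M. (\<lambda>k. if k \<in> I then X k \<omega> else 0) \<in> E \<omega>}"
  proof (rule nn_integral_indicator)
    have "{\<omega> \<in> space M. (\<lambda>k. if k \<in> I then X k \<omega> else 0) \<in> E \<omega>} = (\<Union>x\<in>D. {\<omega> \<in> space M. x \<in> E \<omega>} \<inter> C x)"
    proof (intro equalityI subsetI)
      fix \<omega> assume "\<omega> \<in> {\<omega> \<in> space M. (\<lambda>k. if k \<in> I then X k \<omega> else 0) \<in> E \<omega>}"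
      then show "\<omega> \<in> (\<Union>x\<in>D. {\<omega> \<in> space M. x \<in> E \<omega>} \<inter> C x)"
        by (intro UN_I[of "\<lambda>k. if k \<in> I then X k \<omega> else 0"]) (auto simp: D_def C_def PiE_dflt_def)
    next
      fix \<omega> assume "\<omega> \<in> (\<Union>x\<in>D. {\<omega> \<in> space M. x \<in> E \<omega>} \<inter> C x)"
      then obtain x where x: "x \<in> D" "\<omega> \<in> space M" "x \<in> E \<omega>" "\<omega> \<in> C x" by auto
      then have "(\<lambda>k. if k \<in> I then X k \<omega> else 0) = x"
        by (auto simp: D_def C_def PiE_dflt_def fun_eq_iff)
      with x show "\<omega> \<in> {\<omega> \<in> space M. (\<lambda>k. if k \<in> I then X k \<omega> else 0) \<in> E \<omega>}" by simp
    qed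
    also have "\<dots> \<in> sets M" using C by (intro sets.countable_UN' countable_D) auto
    finally show "{\<omega> \<in> space M. (\<lambda>k. if k \<in> I then X k \<omega> else 0) \<in> E \<omega>} \<in> sets M" .
  qed
  finally show "emeasure M {\<omega> \<in> space M. (\<lambda>k. if k \<in> I then X k \<omega> else 0) \<in> E \<omega>}
      = (\<integral>\<^sup>+\<omega>. ennreal (measure_pmf.prob (Pi_pmf I 0 (\<lambda>k. \<mu> k \<omega>)) (E \<omega>)) \<partial>M)" ..
qed

end

section \<open>Integrating the pointwise bounds over the weights\<close>

text \<open>
  The function \<open>Z\<close> need not be measurable, so its integral is only the supremum over the
  measurable functions below it; hence the detour through \<open>(d - \<alpha>) / \<beta> \<le> Z\<close>.
\<close>

lemma (in prob_space) nn_integral_le_affine: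
  fixes d Z :: "'a \<Rightarrow> real"
  assumes [measurable]: "d \<in> borel_measurable M" and \<alpha>\<beta>: "0 \<le> \<alpha>" "0 < \<beta>"
    and le: "AE \<omega> in M. d \<omega> \<le> \<alpha> + \<beta> * Z \<omega>"
  shows "(\<integral>\<^sup>+\<omega>. ennreal (d \<omega>) \<partial>M) \<le> ennreal \<alpha> + ennreal \<beta> * (\<integral>\<^sup>+\<omega>. ennreal (Z \<omega>) \<partial>M)"
proof -
  define y where "y \<omega> = (d \<omega> - \<alpha>) / \<beta>" for \<omega>
  have [measurable]: "y \<in> borel_measurable M" unfolding y_def by measurable
  have "ennreal (d \<omega>) \<le> ennreal \<alpha> + ennreal \<beta> * ennreal (y \<omega>)" for \<omega>
  proof (cases "0 \<le> y \<omega>")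
    case True
    then have "ennreal \<alpha> + ennreal \<beta> * ennreal (y \<omega>) = ennreal (\<alpha> + \<beta> * y \<omega>)"
      using \<alpha>\<beta> by (simp add: ennreal_mult ennreal_plus)
    also have "\<alpha> + \<beta> * y \<omega> = d \<omega>" using \<alpha>\<beta> by (simp add: y_def)
    finally show ?thesis by simp
  next
    case False
    then have "d \<omega> \<le> \<alpha>" using \<alpha>\<beta> by (simp add: y_def field_simps)
    then show ?thesis by (simp add: ennreal_leI add_increasing2)
  qed
  then have "(\<integral>\<^sup>+\<omega>. ennreal (d \<omega>) \<partial>M) \<le> (\<integral>\<^sup>+\<omega>. ennreal \<alpha> + ennreal \<beta> * ennreal (y \<omega>) \<partial>M)"
    by (rule nn_integral_mono)
  also have "\<dots> = ennreal \<alpha> + ennreal \<beta> * (\<integral>\<^sup>+\<omega>. ennreal (y \<omega>) \<partial>M)"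
    by (subst nn_integral_add) (simp_all add: nn_integral_cmult emeasure_space_1)
  also have "(\<integral>\<^sup>+\<omega>. ennreal (y \<omega>) \<partial>M) \<le> (\<integral>\<^sup>+\<omega>. ennreal (Z \<omega>) \<partial>M)"
  proof (rule nn_integral_mono_AE)
    show "AE \<omega> in M. ennreal (y \<omega>) \<le> ennreal (Z \<omega>)"
      using le by eventually_elim (use \<alpha>\<beta> in \<open>auto intro!: ennreal_leI simp: y_def field_simps\<close>)
  qed
  finally show ?thesis by (simp add: mult_left_mono add_left_mono)
qed

text \<open>The right side is the tangent at \<open>m\<close> of the concave power function, an
  affine function of \<open>x\<close> and thus within reach of
  \<open>nn_integral_le_affine\<close>.\<close>

lemma powr_le_tangent:
  fixes x m \<theta> :: real
  assumes "0 < x" "0 < m" "0 < \<theta>" "\<theta> < 1"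
  shows "x powr \<theta> \<le> (1 - \<theta>) * m powr \<theta> + \<theta> * m powr (\<theta> - 1) * x"
proof -
  have "x powr \<theta> * m powr (1 - \<theta>) \<le> \<theta> * x + (1 - \<theta>) * m"
    using assms by (intro Youngs_inequality_0) auto
  then have "m powr (\<theta> - 1) * (x powr \<theta> * m powr (1 - \<theta>)) \<le> m powr (\<theta> - 1) * (\<theta> * x + (1 - \<theta>) * m)"
    by (rule mult_left_mono) simp
  moreover have "m powr (\<theta> - 1) * m powr (1 - \<theta>) = 1" "m powr (\<theta> - 1) * m = m powr \<theta>"
    using assms powr_add[of m "\<theta> - 1" "1 - \<theta>"] powr_add[of m "\<theta> - 1" 1] by simp_all
  ultimately show ?thesis by (simp add: algebra_simps)
qed

text \<open>This is Jensen's inequality by tangents. The tangent is taken at points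
  \<open>m > z\<close> that decrease to the integral \<open>z\<close>, so that the point of tangency
  is positive: for a non-measurable \<open>Z\<close> the integral can be 0 although \<open>Z\<close>
  is positive almost everywhere.\<close>

lemma (in prob_space) nn_integral_le_powr:
  fixes d Z :: "'a \<Rightarrow> real"
  assumes d[measurable]: "d \<in> borel_measurable M" and ab: "0 < a" "0 \<le> b" and \<theta>: "0 < \<theta>" "\<theta> < 1"
    and Z: "AE \<omega> in M. 0 < Z \<omega>"
    and le: "AE \<omega> in M. d \<omega> \<le> a * Z \<omega> + b * Z \<omega> powr \<theta>"
  shows "(\<integral>\<^sup>+\<omega>. ennreal (d \<omega>) \<partial>M) \<le> ennreal a * (\<integral>\<^sup>+\<omega>. ennreal (Z \<omega>) \<partial>M)
    + ennreal b * ennreal_powr (\<integral>\<^sup>+\<omega>. ennreal (Z \<omega>) \<partial>M) \<theta>"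
proof (cases "(\<integral>\<^sup>+\<omega>. ennreal (Z \<omega>) \<partial>M) = \<infinity>")
  case True
  then show ?thesis using ab by (simp add: ennreal_mult_top)
next
  case False
  define z where "z = enn2real (\<integral>\<^sup>+\<omega>. ennreal (Z \<omega>) \<partial>M)"
  have z0: "0 \<le> z" by (simp add: z_def)
  have z: "(\<integral>\<^sup>+\<omega>. ennreal (Z \<omega>) \<partial>M) = ennreal z" using False by (simp add: z_def less_top)
  have bound: "(\<integral>\<^sup>+\<omega>. ennreal (d \<omega>) \<partial>M) \<le> ennreal (a * z + b * m powr \<theta>)" if m: "z < m" for m
  proof -
    have m0: "0 < m" using m z0 by simp
    define \<alpha> \<beta> where "\<alpha> = b * (1 - \<theta>) * m powr \<theta>" and "\<beta> = a + b * \<theta> * m powr (\<theta> - 1)"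
    have \<alpha>\<beta>: "0 \<le> \<alpha>" "0 < \<beta>"
      using ab \<theta> by (auto simp: \<alpha>_def \<beta>_def intro!: add_pos_nonneg)
    have "AE \<omega> in M. d \<omega> \<le> \<alpha> + \<beta> * Z \<omega>"
      using le Z
    proof eventually_elim
      case (elim \<omega>)
      have "b * Z \<omega> powr \<theta> \<le> b * ((1 - \<theta>) * m powr \<theta> + \<theta> * m powr (\<theta> - 1) * Z \<omega>)"
        using ab by (intro mult_left_mono powr_le_tangent elim m0 \<theta>) auto
      with elim show ?case by (simp add: \<alpha>_def \<beta>_def algebra_simps)
    qed
    from nn_integral_le_affine[OF d \<alpha>\<beta> this]
    have "(\<integral>\<^sup>+\<omega>. ennreal (d \<omega>) \<partial>M) \<le> ennreal (\<alpha> + \<beta> * z)"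
      using \<alpha>\<beta> z0 by (simp add: z ennreal_mult ennreal_plus)
    also have "\<alpha> + \<beta> * z \<le> a * z + b * m powr \<theta>"
    proof -
      have "b * \<theta> * m powr (\<theta> - 1) * z \<le> b * \<theta> * m powr (\<theta> - 1) * m"
        using ab \<theta> m by (intro mult_left_mono) auto
      also have "\<dots> = b * \<theta> * m powr \<theta>" using m0 powr_add[of m "\<theta> - 1" 1] by simp
      finally show ?thesis by (simp add: \<alpha>_def \<beta>_def algebra_simps)
    qed
    finally show ?thesis by (simp add: ennreal_leI)
  qed
  have "((\<lambda>m. ennreal (a * z + b * m powr \<theta>)) \<longlongrightarrow> ennreal (a * z + b * z powr \<theta>)) (at_right z)"
  proof (intro tendsto_ennrealI tendsto_intros tendsto_powr')
    have "\<forall>\<^sub>F m in at_right z. 0 \<le> m"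
      using eventually_at_right_less[of z] by eventually_elim (use z0 in simp)
    then show "z \<noteq> 0 \<or> 0 < \<theta> \<and> (\<forall>\<^sub>F m in at_right z. 0 \<le> m)" using \<theta> by simp
  qed
  then have "(\<integral>\<^sup>+\<omega>. ennreal (d \<omega>) \<partial>M) \<le> ennreal (a * z + b * z powr \<theta>)"
  proof (rule tendsto_lowerbound)
    show "\<forall>\<^sub>F m in at_right z. (\<integral>\<^sup>+\<omega>. ennreal (d \<omega>) \<partial>M) \<le> ennreal (a * z + b * m powr \<theta>)"
      using eventually_at_right_less[of z] by eventually_elim (rule bound)
  qed simp
  also have "\<dots> = ennreal a * ennreal z + ennreal b * ennreal (z powr \<theta>)"
    using ab z0 by (simp add: ennreal_mult ennreal_plus)
  finally show ?thesis using z0 by (simp add: z ennreal_powr_def)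
qed

section \<open>Comparison with the stated constants through a zeta value of at least 1\<close>

lemma zeta_real_ge_1:
  assumes "1 < s"
  shows "1 \<le> zeta_real s"
proof -
  have "summable (\<lambda>n. real (Suc n) powr (- s))"
    using summable_real_powr_iff[of "- s"] assms by (subst summable_Suc_iff) simp
  then have sm: "summable (\<lambda>n. 1 / real (Suc n) powr s)"
    by (simp add: powr_minus divide_inverse)
  have "(\<Sum>n\<in>{0::nat}. 1 / real (Suc n) powr s) \<le> (\<Sum>n. 1 / real (Suc n) powr s)"
    by (rule sum_le_suminf[OF sm]) auto
  then show ?thesis by (simp add: zeta_real_def)
qed

lemma C1_const_ge:
  assumes "0 < \<theta>" "0 < k"
  shows "2 * \<theta>\<^sup>2 + 16 * \<theta> * k \<le> C1_const \<theta> k"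
proof -
  have "16 * \<theta> \<le> 6 * \<theta> + 10 * \<theta> * zeta_real (1 + \<theta>)"
    using zeta_real_ge_1[of "1 + \<theta>"] assms by simp
  then have "16 * \<theta> * k \<le> (6 * \<theta> + 10 * \<theta> * zeta_real (1 + \<theta>)) * max (exp (- \<theta> * euler_mascheroni) / Gamma \<theta>) k"
    using assms by (intro mult_mono) auto
  then show ?thesis by (simp add: C1_const_def)
qed

lemma C2_const_ge:
  assumes "0 < \<theta>"
  shows "3 * (6 * \<theta>) powr \<theta> \<le> C2_const \<theta>"
proof -
  have "6 * \<theta> \<le> 2 * \<theta> + 4 * \<theta> * zeta_real (1 + \<theta>)"
    using zeta_real_ge_1[of "1 + \<theta>"] assms by simp
  then show ?thesis using assms unfolding C2_const_def by (intro mult_left_mono powr_mono2) auto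
qed

lemma measurable_array_sigma:
  assumes "1 \<le> k" "k \<le> n"
  shows "W n k \<in> borel_measurable (array_sigma M W)"
proof (rule measurableI)
  have *: "(\<Union>n\<in>{1..}. \<Union>k\<in>{1..n}. {W n k -` B \<inter> space M | B. B \<in> sets borel}) \<subseteq> Pow (space M)"
    by auto
  fix B :: "real set" assume "B \<in> sets borel"
  then show "W n k -` B \<inter> space (array_sigma M W) \<in> sets (array_sigma M W)"
    unfolding array_sigma_def sets_measure_of[OF *] space_measure_of[OF *]
    using assms by (intro sigma_sets.Basic) fastforce
qed simp

lemma cdf_increment_density_bound:
  assumes N: "finite_borel_measure N" and p[measurable]: "p \<in> borel_measurable borel"
    and dens: "N = density lborel (\<lambda>x. ennreal (p x))"
    and k: "0 \<le> k" "\<And>x. a \<le> x \<Longrightarrow> p x \<le> k" and x: "a \<le> x"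
  shows "cdf N x - cdf N a \<le> k * (x - a)"
proof (cases "a = x")
  case False
  then have ax: "a < x" using x by simp
  interpret finite_borel_measure N by (rule N)
  have "ennreal (cdf N x - cdf N a) = emeasure N {a<..x}"
    by (simp add: cdf_diff_eq[OF ax] emeasure_eq_measure)
  also have "\<dots> = (\<integral>\<^sup>+y\<in>{a<..x}. ennreal (p y) \<partial>lborel)"
    unfolding dens by (rule emeasure_density) auto
  also have "\<dots> \<le> (\<integral>\<^sup>+y\<in>{a<..x}. ennreal k \<partial>lborel)"
    using k by (intro nn_integral_mono) (auto split: split_indicator intro: ennreal_leI)
  also have "\<dots> = ennreal (k * (x - a))"
    using k ax by (simp add: nn_integral_cmult_indicator ennreal_mult)
  finally show ?thesis using k ax by (simp add: ennreal_le_iff)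
qed simp

theorem theorem1p3:
  fixes M :: "'a measure" and \<theta> k\<^sub>\<theta> :: real
    and W :: "nat \<Rightarrow> nat \<Rightarrow> 'a \<Rightarrow> real" and X :: "nat \<Rightarrow> 'a \<Rightarrow> nat"
    and \<mu> \<mu>s :: "nat \<Rightarrow> 'a \<Rightarrow> nat pmf" and \<sigma> :: "nat \<Rightarrow> 'a \<Rightarrow> nat \<Rightarrow> nat"
    and \<nu> :: "real measure" and p :: "real \<Rightarrow> real"
  defines "F \<equiv> array_sigma M W"
    and "l \<equiv> \<lambda>k \<omega>. enn2real (cond_mean M (array_sigma M W) (X k) \<omega>)"
  assumes "prob_space M" and "\<theta> > 0"
    and dickman: "dickman_law \<theta> \<nu>"
    and density: "p \<in> borel_measurable borel" "\<nu> = density lborel (\<lambda>x. ennreal (p x))"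
    and bound: "k\<^sub>\<theta> > 0" "\<And>x. x \<ge> 1 \<Longrightarrow> p x \<le> k\<^sub>\<theta>"
    and W: "\<And>n k. 1 \<le> k \<Longrightarrow> k \<le> n \<Longrightarrow> integrable M (W n k)"
      "\<And>n k \<omega>. 1 \<le> k \<Longrightarrow> k \<le> n \<Longrightarrow> \<omega> \<in> space M \<Longrightarrow> 0 \<le> W n k \<omega>"
    and X: "cond_indep_nat M F X {1..}"
    and mean: "\<And>k. k \<ge> 1 \<Longrightarrow> AE \<omega> in M. cond_mean M F (X k) \<omega> < \<infinity>"
    and law: "\<And>k. k \<ge> 1 \<Longrightarrow> cond_law M F (X k) (\<mu> k)"
    and law_size_biased:
      "\<And>k. k \<ge> 1 \<Longrightarrow> AE \<omega> in M. l k \<omega> > 0 \<longrightarrow> size_biased (\<mu> k \<omega>) (\<mu>s k \<omega>)"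
    and perm: "\<And>n. n \<ge> 1 \<Longrightarrow> sorting_perm F n (W n) (\<sigma> n)"
  defines "S \<equiv> \<lambda>n \<omega>. \<Sum>k=1..n. W n k \<omega> * real (X k \<omega>)"
    and "E \<equiv> \<lambda>n. \<integral>\<^sup>+ \<omega>. ennreal (eps_os \<theta> n (\<lambda>k. W n k \<omega>) (\<lambda>k. l k \<omega>) (\<sigma> n \<omega>)
                              (\<lambda>k. \<mu> k \<omega>) (\<lambda>k. \<mu>s k \<omega>)) \<partial>M"
  shows "\<forall>n\<ge>1. ennreal (kolmogorov_dist (distr M borel (S n)) \<nu>) \<le>
    (if \<theta> \<ge> 1 then ennreal (C1_const \<theta> k\<^sub>\<theta>) * E n
     else ennreal (2 * \<theta>\<^sup>2) * E n + ennreal (C2_const \<theta>) * ennreal_powr (E n) \<theta>)"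
proof (intro allI impI)
  fix n :: nat assume n: "1 \<le> n"
  have sub: "subalgebra M F"
    unfolding F_def by (rule subalgebra_array_sigma) (rule borel_measurable_integrable[OF W(1)])
  interpret prob_space M by fact
  interpret prob_subalgebra M F by unfold_locales (rule sub)
  interpret D: dickman \<theta> \<nu> by unfold_locales (fact \<open>\<theta> > 0\<close> dickman)+
  have X_M: "X k \<in> measurable M (count_space UNIV)" if "1 \<le> k" for k
    using X that by (simp add: cond_indep_nat_def)
  have W_F: "W n k \<in> borel_measurable F" if "k \<in> {1..n}" for k
    unfolding F_def using that by (intro measurable_array_sigma) auto
  have W_M: "W n k \<in> borel_measurable M" if "k \<in> {1..n}" for k
    by (rule measurable_from_subalg[OF sub W_F[OF that]])
  have S_M: "S n \<in> borel_measurable M"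
    unfolding S_def using X_M
    by (intro borel_measurable_sum borel_measurable_times W_M measurable_compose[OF X_M]) auto
  \<comment> \<open>The size-biased laws \<open>\<mu>s\<close> are constrained only almost
    everywhere and carry no measurability, so \<open>Z\<close> is not known to be
    measurable.\<close>
  define Z where "Z \<omega> = eps_os \<theta> n (\<lambda>k. W n k \<omega>) (\<lambda>k. l k \<omega>) (\<sigma> n \<omega>) (\<lambda>k. \<mu> k \<omega>) (\<lambda>k. \<mu>s k \<omega>)" for \<omega>
  define A where "A t \<omega> = {x :: nat \<Rightarrow> nat. (\<Sum>k=1..n. W n k \<omega> * real (x k)) \<le> t}" for t \<omega>
  define g where "g t \<omega> = measure_pmf.prob (Pi_pmf {1..n} 0 (\<lambda>k. \<mu> k \<omega>)) (A t \<omega>)" for t \<omega>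
  \<comment> \<open>Finitely many almost sure properties are combined, after which every remaining
    realisation satisfies the deterministic hypotheses.\<close>
  have approx: "AE \<omega> in M. dickman_approximation n (\<lambda>k. W n k \<omega>) (\<lambda>k. l k \<omega>) (\<lambda>k. \<mu> k \<omega>) (\<lambda>k. \<mu>s k \<omega>) (\<sigma> n \<omega>) \<theta> \<nu>"
  proof -
    have "AE \<omega> in M. \<forall>k\<in>{1..n}. cond_mean M F (X k) \<omega> < \<infinity>"
      by (intro AE_finite_allI mean) auto
    moreover have "AE \<omega> in M. \<forall>k\<in>{1..n}. (\<integral>\<^sup>+x. ennreal (real x) \<partial>\<mu> k \<omega>) = cond_mean M F (X k) \<omega>"
      unfolding cond_mean_def by (intro AE_finite_allI nn_cond_exp_cond_law law X_M) auto
    moreover have "AE \<omega> in M. \<forall>k\<in>{1..n}. l k \<omega> > 0 \<longrightarrow> size_biased (\<mu> k \<omega>) (\<mu>s k \<omega>)"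
      by (intro AE_finite_allI law_size_biased) auto
    ultimately show ?thesis using AE_space
    proof eventually_elim
      case (elim \<omega>)
      have perm_\<omega>: "\<sigma> n \<omega> permutes {1..n}"
        "\<And>k. 1 \<le> k \<Longrightarrow> k \<le> n \<Longrightarrow> W n (\<sigma> n \<omega> k) \<omega> = order_stat n (\<lambda>j. W n j \<omega>) k"
        using perm[OF n] elim(4) sub by (auto simp: sorting_perm_def subalgebra_def)
      have fin: "integrable (measure_pmf (\<mu> k \<omega>)) real" if "1 \<le> k" "k \<le> n" for k
      proof (rule integrableI_bounded)
        have "(\<integral>\<^sup>+x. ennreal (norm (real x)) \<partial>\<mu> k \<omega>) = cond_mean M F (X k) \<omega>"
          using elim(2) that by simp
        then show "(\<integral>\<^sup>+x. ennreal (norm (real x)) \<partial>\<mu> k \<omega>) < \<infinity>"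
          using elim(1) that by simp
      qed simp
      have "l k \<omega> = measure_pmf.expectation (\<mu> k \<omega>) real" if "1 \<le> k" "k \<le> n" for k
      proof -
        have "l k \<omega> = enn2real (\<integral>\<^sup>+x. ennreal (real x) \<partial>\<mu> k \<omega>)"
          using elim(2) that by (simp add: l_def F_def)
        also have "\<dots> = measure_pmf.expectation (\<mu> k \<omega>) real"
          by (rule integral_eq_nn_integral[symmetric]) auto
        finally show ?thesis .
      qed
      with n \<open>\<theta> > 0\<close> W(2) elim(3,4) perm_\<omega> fin show ?case
        by unfold_locales auto
    qed
  qed
  have Z_pos: "AE \<omega> in M. 0 < Z \<omega>"
    using approx
  proof eventually_elim
    case (elim \<omega>)
    then show ?case
      unfolding Z_def by (intro weighted_sum.eps_pos dickman_approximation.axioms(1))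
  qed
  have A_F: "{\<omega> \<in> space M. x \<in> A t \<omega>} \<in> sets F" for t x
  proof -
    have "(\<lambda>\<omega>. \<Sum>k=1..n. W n k \<omega> * real (x k)) \<in> borel_measurable F"
      by (intro borel_measurable_sum borel_measurable_times W_F borel_measurable_const)
    then have "{\<omega> \<in> space F. (\<Sum>k=1..n. W n k \<omega> * real (x k)) \<le> t} \<in> sets F"
      by measurable
    then show ?thesis using sub by (simp add: A_def subalgebra_def)
  qed
  have law': "cond_law M F (X k) (\<mu> k)" if "k \<in> {1..n}" for k using law that by simp
  have g_M: "g t \<in> borel_measurable M" for t
    unfolding g_def by (rule measurable_conditional_prob[OF _ _ _ X law' A_F]) (use n in auto)
  have cdf_S: "cdf (distr M borel (S n)) t = (\<integral>\<omega>. g t \<omega> \<partial>M)" for t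
  proof -
    have "{\<omega> \<in> space M. (\<lambda>k. if k \<in> {1..n} then X k \<omega> else 0) \<in> A t \<omega>} = S n -` {..t} \<inter> space M"
      by (auto simp: A_def S_def)
    then have "ennreal (cdf (distr M borel (S n)) t)
        = emeasure M {\<omega> \<in> space M. (\<lambda>k. if k \<in> {1..n} then X k \<omega> else 0) \<in> A t \<omega>}"
      using S_M by (simp add: cdf_def measure_distr emeasure_eq_measure)
    also have "\<dots> = (\<integral>\<^sup>+\<omega>. ennreal (g t \<omega>) \<partial>M)"
      unfolding g_def by (rule prob_eq_integral_conditional_prob[OF _ _ _ X law' A_F]) (use n in auto)
    also have "\<dots> = ennreal (\<integral>\<omega>. g t \<omega> \<partial>M)"
      by (intro nn_integral_eq_integral integrable_const_bound[where B=1] g_M) (auto simp: g_def)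
    finally show ?thesis
      by (simp add: g_def cdf_def integral_nonneg_AE)
  qed
  \<comment> \<open>The target \<open>cdf \<nu> t\<close> does not depend on \<omega>, so the
    distance of the averages is at most the average of the distances for frozen weights.\<close>
  have dist: "ennreal \<bar>cdf (distr M borel (S n)) t - cdf \<nu> t\<bar> \<le> (\<integral>\<^sup>+\<omega>. ennreal \<bar>g t \<omega> - cdf \<nu> t\<bar> \<partial>M)" for t
  proof -
    have int: "integrable M (g t)"
      by (intro integrable_const_bound[where B=1] g_M) (auto simp: g_def)
    then have "\<bar>cdf (distr M borel (S n)) t - cdf \<nu> t\<bar> = \<bar>\<integral>\<omega>. g t \<omega> - cdf \<nu> t \<partial>M\<bar>"
      by (simp add: cdf_S prob_space)
    also have "\<dots> \<le> (\<integral>\<omega>. \<bar>g t \<omega> - cdf \<nu> t\<bar> \<partial>M)"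
      by (rule integral_abs_bound)
    finally have "ennreal \<bar>cdf (distr M borel (S n)) t - cdf \<nu> t\<bar> \<le> ennreal (\<integral>\<omega>. \<bar>g t \<omega> - cdf \<nu> t\<bar> \<partial>M)"
      by (rule ennreal_leI)
    also have "\<dots> = (\<integral>\<^sup>+\<omega>. ennreal \<bar>g t \<omega> - cdf \<nu> t\<bar> \<partial>M)"
      using int by (intro nn_integral_eq_integral[symmetric]) auto
    finally show ?thesis .
  qed
  have d_M: "(\<lambda>\<omega>. \<bar>g t \<omega> - cdf \<nu> t\<bar>) \<in> borel_measurable M" for t
    using g_M by measurable
  define R where "R = (if \<theta> \<ge> 1 then ennreal (C1_const \<theta> k\<^sub>\<theta>) * E n
     else ennreal (2 * \<theta>\<^sup>2) * E n + ennreal (C2_const \<theta>) * ennreal_powr (E n) \<theta>)"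
  have E: "E n = (\<integral>\<^sup>+\<omega>. ennreal (Z \<omega>) \<partial>M)" by (simp add: E_def Z_def)
  have bound_t: "ennreal \<bar>cdf (distr M borel (S n)) t - cdf \<nu> t\<bar> \<le> R" if t: "0 \<le> t" for t
  proof (cases "1 \<le> \<theta>")
    case True
    have inc: "cdf \<nu> x - cdf \<nu> 1 \<le> k\<^sub>\<theta> * (x - 1)" if "1 \<le> x" for x
      by (rule cdf_increment_density_bound[OF D.finite_borel_measure_M density _ _ that])
        (use bound in auto)
    have C1: "2 * \<theta>\<^sup>2 + 16 * \<theta> * k\<^sub>\<theta> \<le> C1_const \<theta> k\<^sub>\<theta>"
      by (rule C1_const_ge) fact+
    have "0 < C1_const \<theta> k\<^sub>\<theta>"
      using C1 \<open>\<theta> > 0\<close> bound(1) by (intro less_le_trans[OF _ C1]) (simp add: add_pos_pos)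
    have "AE \<omega> in M. \<bar>g t \<omega> - cdf \<nu> t\<bar> \<le> 0 + C1_const \<theta> k\<^sub>\<theta> * Z \<omega>"
      using approx Z_pos
    proof eventually_elim
      case (elim \<omega>)
      have "\<bar>g t \<omega> - cdf \<nu> t\<bar> \<le> (2 * \<theta>\<^sup>2 + 16 * \<theta> * k\<^sub>\<theta>) * Z \<omega>"
        unfolding g_def A_def Z_def
        by (rule dickman_approximation.cdf_bound_ge_1[OF elim(1) True bound(1) t inc])
      also have "\<dots> \<le> C1_const \<theta> k\<^sub>\<theta> * Z \<omega>"
        using C1 elim(2) by (intro mult_right_mono) auto
      finally show ?case by simp
    qed
    from nn_integral_le_affine[OF d_M order_refl \<open>0 < C1_const \<theta> k\<^sub>\<theta>\<close> this] dist[of t] True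
    show ?thesis by (auto simp: R_def E intro: order_trans)
  next
    case False
    have C2: "3 * (6 * \<theta>) powr \<theta> \<le> C2_const \<theta>" by (rule C2_const_ge) fact
    have "0 \<le> C2_const \<theta>" by (rule order_trans[OF _ C2]) simp
    have "AE \<omega> in M. \<bar>g t \<omega> - cdf \<nu> t\<bar> \<le> 2 * \<theta>\<^sup>2 * Z \<omega> + C2_const \<theta> * Z \<omega> powr \<theta>"
      using approx Z_pos
    proof eventually_elim
      case (elim \<omega>)
      have "\<bar>g t \<omega> - cdf \<nu> t\<bar> \<le> 2 * \<theta>\<^sup>2 * Z \<omega> + 3 * (6 * \<theta> * Z \<omega>) powr \<theta>"
        unfolding g_def A_def Z_def
        by (rule dickman_approximation.cdf_bound_less_1[OF elim(1) _ t]) (use False in simp)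
      also have "3 * (6 * \<theta> * Z \<omega>) powr \<theta> = 3 * (6 * \<theta>) powr \<theta> * Z \<omega> powr \<theta>"
        using elim(2) \<open>\<theta> > 0\<close> by (simp add: powr_mult)
      also have "\<dots> \<le> C2_const \<theta> * Z \<omega> powr \<theta>"
        using C2 by (intro mult_right_mono) auto
      finally show ?case by simp
    qed
    from nn_integral_le_powr[OF d_M _ \<open>0 \<le> C2_const \<theta>\<close> \<open>\<theta> > 0\<close> _ Z_pos this] dist[of t] False \<open>\<theta> > 0\<close>
    show ?thesis by (auto simp: R_def E intro: order_trans)
  qed
  have "ennreal (kolmogorov_dist (distr M borel (S n)) \<nu>) \<le> R"
  proof (cases "R = \<infinity>")
    case False
    then have R: "R = ennreal (enn2real R)" by (simp add: less_top)
    have "\<bar>cdf (distr M borel (S n)) t - cdf \<nu> t\<bar> \<le> enn2real R" if "0 \<le> t" for t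
      using bound_t[OF that] R by (metis enn2real_nonneg ennreal_le_iff)
    then have "kolmogorov_dist (distr M borel (S n)) \<nu> \<le> enn2real R"
      unfolding kolmogorov_dist_def by (intro cSUP_least) auto
    then show ?thesis using R by (metis ennreal_leI)
  qed simp
  then show "ennreal (kolmogorov_dist (distr M borel (S n)) \<nu>) \<le>
    (if \<theta> \<ge> 1 then ennreal (C1_const \<theta> k\<^sub>\<theta>) * E n
     else ennreal (2 * \<theta>\<^sup>2) * E n + ennreal (C2_const \<theta>) * ennreal_powr (E n) \<theta>)"
    unfolding R_def .
qed

end
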